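(* Let $m\ge 1$, $n=2m+2$, and let $L$ be a uniformly elliptic operator of order $2m$ on $\mathbb{R}^n$ with constant coefficients involving only the highest order derivatives, with symbol $Q$. Then the fundamental solution $K_L$ is given, for $x\ne y$ and with $\eta:=\frac{x-y}{|x-y|}$, by $$K_{L}(x,y)=\frac{1}{2^{2m+1}\pi^{2m+2}|x-y|^2}\Bigg\{\frac{n-2}{2}\int_{|\xi|=1}\frac{1}{Q(\xi)}\,d\mathcal{H}^{n-1}(\xi)+\int_{\{|\xi|=1,\ (x-y)\cdot\xi>0\}}\log(\xi\cdot\eta)\bigg[(4m+4-n)(\xi\cdot\eta)\,\nabla\frac{1}{Q(\xi)}(\eta)+2m\frac{1}{Q(\xi)}+\nabla^2\frac{1}{Q(\xi)}\big(\eta^{\otimes 2}\big)+(\xi\cdot\eta)^2\,\Delta\frac{1}{Q(\xi)}\bigg]d\mathcal{H}^{n-1}(\xi)\Bigg\}.$$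
   Context: Operators: $L=(-1)^m Q\left(\frac{\partial}{\partial x_1},\dots,\frac{\partial}{\partial x_n}\right)$, where $Q(\xi)=\sum_{i_1,\dots,i_{2m}=1}^n A_{i_1,\dots,i_{2m}}\xi_{i_1}\cdots\xi_{i_{2m}}$ is a real $2m$-homogeneous polynomial on $\mathbb{R}^n$, called the symbol of $L$. Uniform ellipticity: there is $\lambda>0$ with $Q(\xi)\ge\lambda|\xi|^{2m}$ for all $\xi\in\mathbb{R}^n$. Fundamental solution: for even $n\ge 2m$, $K_L$ denotes John's fundamental solution $$K_L(x,y)=-\frac{1}{(2\pi)^{n}}(-\Delta_y)^{\frac{n-2m}{2}}\int_{|\xi|=1}\frac{\log|(x-y)\cdot\xi|}{Q(\xi)}\,d\mathcal{H}^{n-1}(\xi),\qquad x\ne y.$$ It satisfies $\int_{\mathbb{R}^n}K_L(x,y)L\psi(y)\,dy=\psi(x)$ for all $\psi\in C_0^\infty(\mathbb{R}^n)$. Notation: $\mathcal{H}^k$ is the $k$-dimensional Hausdorff measure. For a function $f$ and $v\in\mathbb{R}^n$: $\nabla f(\xi)(v)=\sum_h\partial_h f(\xi)v_h$ and $\nabla^2 f(\xi)(v^{\otimes 2})=\sum_{h,k}\partial_h\partial_k f(\xi)v_hv_k$; $\nabla\frac1{Q(\xi)}$, $\nabla^2\frac1{Q(\xi)}$, $\Delta\frac{1}{Q(\xi)}$ are the derivatives of the function $1/Q$ on $\mathbb{R}^n\setminus\{0\}$, evaluated at $\xi$. *)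

theory Defs
  imports "HOL-Analysis.Analysis"
begin

section \<open>Hausdorff measure\<close>

text \<open>The normalisation \<open>unit_ball_vol k / 2 ^ k\<close> makes the \<open>k\<close>-dimensional measure agree
  with Lebesgue measure on \<open>k\<close>-dimensional Euclidean space. Boundedness of the covering sets is required
  because \<^const>\<open>diameter\<close> is unspecified on unbounded sets; the case distinction for
  empty sets matters only for \<open>k = 0\<close>, where \<open>0 ^ 0 = 1\<close>.\<close>

definition hausdorff_content :: "nat \<Rightarrow> real \<Rightarrow> 'a::metric_space set \<Rightarrow> ennreal" where
  "hausdorff_content k \<delta> A =
    (INF C\<in>{C :: nat \<Rightarrow> 'a set. A \<subseteq> (\<Union>i. C i) \<and> (\<forall>i. bounded (C i) \<and> diameter (C i) \<le> \<delta>)}.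
       \<Sum>i. if C i = {} then 0
           else ennreal (unit_ball_vol (real k) * (diameter (C i) / 2) ^ k))"

definition hausdorff_outer_measure :: "nat \<Rightarrow> 'a::metric_space set \<Rightarrow> ennreal" where
  "hausdorff_outer_measure k A = (SUP \<delta>\<in>{0<..}. hausdorff_content k \<delta> A)"

text \<open>The outer measure is additive on sets of positive distance, hence, by Caratheodory's
  criterion, countably additive on the Borel sets; so \<^const>\<open>measure_of\<close> does not
  collapse to the null measure here.\<close>

definition hausdorff_measure :: "nat \<Rightarrow> 'a::metric_space measure" where
  "hausdorff_measure k = measure_of UNIV (sets borel) (hausdorff_outer_measure k)"


section \<open>Partial derivatives\<close>

definition partial :: "'n::finite \<Rightarrow> (real ^ 'n \<Rightarrow> real) \<Rightarrow> real ^ 'n \<Rightarrow> real" where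
  "partial i f x = deriv (\<lambda>t. f (x + t *\<^sub>R axis i 1)) 0"

definition laplacian :: "(real ^ 'n::finite \<Rightarrow> real) \<Rightarrow> real ^ 'n \<Rightarrow> real" where
  "laplacian f x = (\<Sum>i\<in>UNIV. partial i (partial i f) x)"

definition grad_form :: "(real ^ 'n::finite \<Rightarrow> real) \<Rightarrow> real ^ 'n \<Rightarrow> real ^ 'n \<Rightarrow> real" where
  "grad_form f \<xi> v = (\<Sum>h\<in>UNIV. partial h f \<xi> * v $ h)"

definition hess_form :: "(real ^ 'n::finite \<Rightarrow> real) \<Rightarrow> real ^ 'n \<Rightarrow> real ^ 'n \<Rightarrow> real" where
  "hess_form f \<xi> v = (\<Sum>h\<in>UNIV. \<Sum>k\<in>UNIV. partial h (partial k f) \<xi> * v $ h * v $ k)"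


section \<open>Homogeneous constant-coefficient operators\<close>

text \<open>The coefficients \<open>A\<close> are indexed by the lists \<open>[i\<^sub>1, \<dots>, i\<^sub>2\<^sub>m]\<close> of coordinate indices;
  no symmetry in the indices is required.\<close>

definition symbol_poly :: "nat \<Rightarrow> ('n::finite list \<Rightarrow> real) \<Rightarrow> real ^ 'n \<Rightarrow> real" where
  "symbol_poly m A \<xi> = (\<Sum>I | length I = 2 * m. A I * (\<Prod>i\<leftarrow>I. \<xi> $ i))"

definition homogeneous_operator ::
    "nat \<Rightarrow> ('n::finite list \<Rightarrow> real) \<Rightarrow> (real ^ 'n \<Rightarrow> real) \<Rightarrow> real ^ 'n \<Rightarrow> real" where
  "homogeneous_operator m A f x =
    (-1) ^ m * (\<Sum>I | length I = 2 * m. A I * foldr partial I f x)"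

definition has_symbol ::
    "nat \<Rightarrow> ((real ^ 'n::finite \<Rightarrow> real) \<Rightarrow> real ^ 'n \<Rightarrow> real) \<Rightarrow> (real ^ 'n \<Rightarrow> real) \<Rightarrow> bool" where
  "has_symbol m L Q \<longleftrightarrow> (\<exists>A. L = homogeneous_operator m A \<and> Q = symbol_poly m A)"

definition uniformly_elliptic :: "nat \<Rightarrow> (real ^ 'n::finite \<Rightarrow> real) \<Rightarrow> bool" where
  "uniformly_elliptic m Q \<longleftrightarrow> (\<exists>c>0. \<forall>\<xi>. Q \<xi> \<ge> c * norm \<xi> ^ (2 * m))"


section \<open>John's fundamental solution\<close>

text \<open>Meaningful for even dimension \<open>n \<ge> 2 * m\<close> and \<open>x \<noteq> y\<close>. The value of the logarithm at \<open>0\<close> (which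
  is \<open>0\<close> in HOL) only concerns a null set of the sphere.\<close>

definition john_fundamental_solution ::
    "nat \<Rightarrow> (real ^ 'n::finite \<Rightarrow> real) \<Rightarrow> real ^ 'n \<Rightarrow> real ^ 'n \<Rightarrow> real" where
  "john_fundamental_solution m Q x y =
    - (1 / (2 * pi) ^ CARD('n)) *
    (((\<lambda>f z. - laplacian f z) ^^ ((CARD('n) - 2 * m) div 2))
      (\<lambda>y. LINT \<xi>:sphere 0 1|hausdorff_measure (CARD('n) - 1). ln \<bar>(x - y) \<bullet> \<xi>\<bar> / Q \<xi>)) y"

end

theory Submission
  imports Defs
begin

text \<open>With \<open>n = 2 m + 2\<close> the kernel is a multiple of the Laplacian of
  \<open>F z = \<integral> ln \<bar>z \<bullet> \<xi>\<bar> g \<xi> d\<sigma>\<close>, where \<open>g = 1 / Q\<close> and \<open>\<sigma>\<close> is the surface measure of the sphere.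
  The line \<open>z + t e\<close> lies in the plane of \<open>z\<close> and \<open>e\<close>, so up to the radial factor it is obtained from
  \<open>a = z / \<bar>z\<bar>\<close> by plane rotations \<open>R\<^sub>\<theta>\<close>, and invariance of \<open>\<sigma>\<close> moves the rotation from the singular
  logarithm onto the smooth function \<open>g\<close>:
  \<open>F (r R\<^sub>\<theta> a) = ln r \<integral> g d\<sigma> + \<integral> ln \<bar>\<xi> \<bullet> a\<bar> g (R\<^sub>\<theta> \<xi>) d\<sigma>\<close>.
  Differentiating twice along each coordinate line and summing produces the bracket, once Euler's
  relations for the homogeneous functions \<open>g\<close> and \<open>\<nabla> g\<close> have removed the radial derivatives.
  Only finiteness and invariance of \<open>\<sigma>\<close> enter; in particular no explicit description of the Hausdorff
  measure of the sphere is needed.\<close>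

section \<open>Hausdorff measure of the sphere\<close>

text \<open>The obstacle is that the second derivatives of
  \<open>ln \<bar>z \<bullet> \<xi>\<bar>\<close> in \<open>z\<close> have size
  \<open>1 / (z \<bullet> \<xi>)^2\<close>, which is not integrable over the sphere, so the
  Laplacian cannot simply be taken under the integral. Once the rotation acts on \<open>g\<close>,
  the logarithm is a fixed weight, and its mere integrability gives dominated convergence. That
  integrability rests on one estimate: a band of half-width \<open>1 / N\<close> around a great
  sphere has measure O(1 / N), which also makes great spheres null.

  Origin of the constants: summed over an orthonormal basis,
  \<open>1 - 2 * (e \<bullet> a)^2\<close> gives n - 2, the factor of the integral of
  \<open>g\<close>. In the bracket, the two mixed Hessian terms contribute 2 (2 m + 1) by Euler's
  relations and the first-order term contributes -(n - 2), together 4 m + 4 - n; the term 2 m / Q is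
  minus the radial derivative of \<open>g\<close>. The integrand is even, so the half sphere counts
  twice, and this 2 turns \<open>(2 * pi) ^ (2 * m + 2)\<close> into
  \<open>2 ^ (2 * m + 1) * pi ^ (2 * m + 2)\<close> and n - 2 into (n - 2) / 2.\<close>

lemma diameter_isometric_image:
  fixes T :: "'a::metric_space \<Rightarrow> 'b::metric_space"
  assumes "\<And>x y. dist (T x) (T y) = dist x y"
  shows "diameter (T ` S) = diameter S"
proof -
  have "(T ` S) \<times> (T ` S) = (\<lambda>(x, y). (T x, T y)) ` (S \<times> S)"
    by auto
  then have "(\<lambda>(x, y). dist x y) ` ((T ` S) \<times> (T ` S)) = (\<lambda>(x, y). dist x y) ` (S \<times> S)"
    by (simp add: image_image case_prod_unfold assms)
  then show ?thesis
    by (simp add: diameter_def)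
qed

lemma bounded_isometric_image:
  fixes T :: "'a::metric_space \<Rightarrow> 'b::metric_space"
  assumes "\<And>x y. dist (T x) (T y) = dist x y" and "bounded S"
  shows "bounded (T ` S)"
proof -
  obtain x e where "\<forall>y\<in>S. dist x y \<le> e"
    using assms(2) by (auto simp: bounded_def)
  then show ?thesis
    unfolding bounded_def by (intro exI[of _ "T x"] exI[of _ e]) (auto simp: assms(1))
qed

lemma hausdorff_content_isometric_image_le:
  fixes T :: "'a::metric_space \<Rightarrow> 'b::metric_space"
  assumes "\<And>x y. dist (T x) (T y) = dist x y"
  shows "hausdorff_content k \<delta> (T ` A) \<le> hausdorff_content k \<delta> A"
  unfolding hausdorff_content_def
proof (rule INF_mono)
  fix C :: "nat \<Rightarrow> 'a set"
  assume "C \<in> {C. A \<subseteq> (\<Union>i. C i) \<and> (\<forall>i. bounded (C i) \<and> diameter (C i) \<le> \<delta>)}"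
  then show "\<exists>D\<in>{D. T ` A \<subseteq> (\<Union>i. D i) \<and> (\<forall>i. bounded (D i) \<and> diameter (D i) \<le> \<delta>)}.
      (\<Sum>i. if D i = {} then 0 else ennreal (unit_ball_vol (real k) * (diameter (D i) / 2) ^ k))
      \<le> (\<Sum>i. if C i = {} then 0 else ennreal (unit_ball_vol (real k) * (diameter (C i) / 2) ^ k))"
    by (intro bexI[of _ "\<lambda>i. T ` C i"])
      (auto simp: diameter_isometric_image[OF assms] simp flip: image_UN
         intro: bounded_isometric_image[OF assms] cong: if_cong)
qed

lemma hausdorff_outer_measure_isometry:
  fixes T :: "'a::metric_space \<Rightarrow> 'b::metric_space"
  assumes iso: "\<And>x y. dist (T x) (T y) = dist x y" and "bij T"
  shows "hausdorff_outer_measure k (T ` A) = hausdorff_outer_measure k A"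
proof -
  have "dist (inv T x) (inv T y) = dist x y" for x y
    by (metis iso assms(2) bij_inv_eq_iff)
  from hausdorff_content_isometric_image_le[of "inv T", OF this]
  have "hausdorff_content k \<delta> A \<le> hausdorff_content k \<delta> (T ` A)" for \<delta>
    by (metis assms(2) bij_betw_imp_inj_on image_inv_f_f)
  then have "hausdorff_content k \<delta> (T ` A) = hausdorff_content k \<delta> A" for \<delta>
    by (intro antisym hausdorff_content_isometric_image_le iso)
  then show ?thesis
    by (simp add: hausdorff_outer_measure_def)
qed

lemma sets_hausdorff_measure [simp, measurable_cong]: "sets (hausdorff_measure k) = sets borel"
  by (simp add: hausdorff_measure_def) (metis sets.sigma_sets_eq space_borel)

lemma space_hausdorff_measure [simp]: "space (hausdorff_measure k) = UNIV"
  using sets_eq_imp_space_eq[OF sets_hausdorff_measure] by simp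

text \<open>\<open>measure_of\<close> assigns to each set either the outer measure or the value 0,
  and the inequality holds in both cases.\<close>

lemma emeasure_hausdorff_measure_le:
  "emeasure (hausdorff_measure k) A \<le> hausdorff_outer_measure k A"
  by (simp add: hausdorff_measure_def emeasure_measure_of_conv)

text \<open>The case distinction built into \<open>measure_of\<close> comes out the same for
  \<open>A\<close> and for its preimage, since both are Borel; what remains is invariance of the
  outer measure.\<close>

lemma emeasure_hausdorff_measure_isometry:
  fixes T :: "'a::metric_space \<Rightarrow> 'a"
  assumes iso: "\<And>x y. dist (T x) (T y) = dist x y" and "bij T" and A: "A \<in> sets borel"
  shows "emeasure (hausdorff_measure k) (T -` A) = emeasure (hausdorff_measure k) A"
proof -
  have "continuous_on UNIV T"
    unfolding continuous_on_iff by (auto simp: iso)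
  then have T: "T \<in> borel_measurable borel"
    by (rule borel_measurable_continuous_onI)
  then have "T -` A \<in> sets borel"
    using measurable_sets[OF T A] by simp
  moreover have "T ` (T -` A) = A"
    using assms(2) by (simp add: bij_is_surj surj_image_vimage_eq)
  then have "hausdorff_outer_measure k (T -` A) = hausdorff_outer_measure k A"
    using hausdorff_outer_measure_isometry[OF iso assms(2), of k "T -` A"] by simp
  moreover have "sigma_sets UNIV (sets (borel :: 'a measure)) = sets borel"
    by (metis sets.sigma_sets_eq space_borel)
  ultimately show ?thesis
    using A by (simp add: hausdorff_measure_def emeasure_measure_of_conv)
qed

section \<open>Finiteness of the Hausdorff measure of the unit sphere, by a packing estimate\<close>

lemma power_diff_le:
  fixes a b :: real
  assumes "0 \<le> b" "b \<le> a"
  shows "a ^ n - b ^ n \<le> real n * a ^ (n - 1) * (a - b)"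
proof -
  have "b ^ (n - Suc i) * a ^ i \<le> a ^ (n - 1)" if "i < n" for i
  proof -
    have "b ^ (n - Suc i) * a ^ i \<le> a ^ (n - Suc i) * a ^ i"
      using assms by (intro mult_right_mono power_mono) auto
    also have "\<dots> = a ^ (n - 1)"
      using that by (simp flip: power_add)
    finally show ?thesis .
  qed
  then have "(\<Sum>i<n. b ^ (n - Suc i) * a ^ i) \<le> real n * a ^ (n - 1)"
    using sum_bounded_above[of "{..<n}" "\<lambda>i. b ^ (n - Suc i) * a ^ i" "a ^ (n - 1)"] by simp
  then show ?thesis
    using assms by (simp add: power_diff_sumr2 mult.commute mult_left_mono)
qed

text \<open>Volume comparison: the balls of radius \<open>e / 2\<close> around the points are
  disjoint and lie in a spherical shell of thickness \<open>e\<close>. The shell has volume O(e),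
  each ball has volume of order \<open>e ^ DIM('a)\<close>, and the quotient leaves the exponent
  \<open>DIM('a) - 1\<close> of the Hausdorff measure.\<close>

lemma card_separated_subset_sphere_le:
  fixes X :: "'a::euclidean_space set"
  assumes X: "X \<subseteq> sphere 0 1" "finite X" and e: "0 < e" "e \<le> 1"
    and sep: "pairwise (\<lambda>x y. e \<le> dist x y) X"
  shows "real (card X) * e ^ (DIM('a) - 1) \<le> real DIM('a) * 4 ^ DIM('a)"
proof -
  define N where "N = DIM('a)"
  define v where "v = unit_ball_vol N"
  have N: "N > 0" "DIM('a) = N"
    by (simp_all add: N_def)
  have v: "v > 0"
    by (simp add: v_def)
  let ?M = "lborel :: 'a measure"
  have "v * (real (card X) * (e / 2) ^ N) = (\<Sum>x\<in>X. measure ?M (ball x (e / 2)))"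
    using e by (simp add: content_ball v_def N)
  also have "\<dots> = measure ?M (\<Union>x\<in>X. ball x (e / 2))"
  proof (rule measure_finite_Union[symmetric, OF X(2)])
    have "ball x (e / 2) \<inter> ball y (e / 2) = {}" if "x \<in> X" "y \<in> X" "x \<noteq> y" for x y
    proof -
      have "e \<le> dist x y"
        using sep that by (auto simp: pairwise_def)
      then show ?thesis
        by (intro disjoint_ballI) simp
    qed
    then show "disjoint_family_on (\<lambda>x. ball x (e / 2)) X"
      by (auto simp: disjoint_family_on_def)
  qed (use emeasure_lborel_ball_finite in \<open>auto simp: less_top[symmetric]\<close>)
  also have "\<dots> \<le> measure ?M (ball 0 (1 + e / 2) - ball 0 (1 - e / 2))"
  proof (rule measure_mono_fmeasurable)
    show "(\<Union>x\<in>X. ball x (e / 2)) \<subseteq> ball 0 (1 + e / 2) - ball 0 (1 - e / 2)"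
    proof clarify
      fix x y assume "x \<in> X" and y: "y \<in> ball x (e / 2)"
      then have "norm x = 1"
        using X by auto
      with y show "y \<in> ball 0 (1 + e / 2) - ball 0 (1 - e / 2)"
        using norm_triangle_ineq2[of x y] norm_triangle_ineq2[of y x]
        by (auto simp: dist_norm norm_minus_commute)
    qed
    show "ball 0 (1 + e / 2) - ball 0 (1 - e / 2) \<in> fmeasurable ?M"
      using emeasure_lborel_ball_finite[of "0::'a"] by (intro fmeasurable.Diff) (auto simp: fmeasurable_def)
  qed (auto intro: borel_open)
  also have "\<dots> = measure ?M (ball 0 (1 + e / 2)) - measure ?M (ball 0 (1 - e / 2))"
    using emeasure_lborel_ball_finite[of "0::'a"] e by (intro measure_Diff) (auto simp: subset_ball less_top[symmetric])
  also have "\<dots> = v * ((1 + e / 2) ^ N - (1 - e / 2) ^ N)"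
    using e by (simp add: content_ball v_def N right_diff_distrib)
  \<comment> \<open>The factor \<open>e\<close> gained here is the thickness of the shell; it lowers
    the exponent from \<open>N\<close> to \<open>N - 1\<close>.\<close>
  also have "(1 + e / 2) ^ N - (1 - e / 2) ^ N \<le> real N * (1 + e / 2) ^ (N - 1) * e"
    using power_diff_le[of "1 - e / 2" "1 + e / 2" N] e by simp
  also have "\<dots> \<le> real N * 2 ^ (N - 1) * e"
    using e by (intro mult_right_mono mult_left_mono power_mono) auto
  finally have "real (card X) * (e / 2) ^ N \<le> real N * 2 ^ (N - 1) * e"
    using v by simp
  moreover have "e ^ N = e ^ (N - 1) * e"
    using N by (cases N) auto
  ultimately have "real (card X) * e ^ (N - 1) \<le> real N * (2 ^ (N - 1) * 2 ^ N)"
    using e by (simp add: power_divide field_simps)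
  also have "\<dots> \<le> real N * (2 ^ N * 2 ^ N)"
    by (intro mult_left_mono mult_right_mono power_increasing) auto
  also have "\<dots> = real N * 4 ^ N"
    by (simp flip: power_mult_distrib)
  finally show ?thesis
    by (simp add: N)
qed

text \<open>A separated set of maximal cardinality is a net: a point farther than \<open>e\<close>
  from all its members could be added. The packing bound ensures that a maximum exists.\<close>

lemma finite_cball_cover_sphere:
  assumes e: "0 < e" "e \<le> 1"
  obtains X :: "'a::euclidean_space set"
  where "finite X" "real (card X) * e ^ (DIM('a) - 1) \<le> real DIM('a) * 4 ^ DIM('a)"
    "sphere 0 1 \<subseteq> (\<Union>x\<in>X. cball x e)"
proof -
  define P :: "'a set \<Rightarrow> bool" where
    "P X \<longleftrightarrow> X \<subseteq> sphere 0 1 \<and> finite X \<and> pairwise (\<lambda>x y. e \<le> dist x y) X" for X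
  define B where "B = nat \<lceil>real DIM('a) * 4 ^ DIM('a) / e ^ (DIM('a) - 1)\<rceil>"
  have bound: "real (card X) * e ^ (DIM('a) - 1) \<le> real DIM('a) * 4 ^ DIM('a)" if "P X" for X
    using that e card_separated_subset_sphere_le unfolding P_def by blast
  have "card X < Suc B" if "P X" for X
  proof -
    have "real (card X) \<le> real DIM('a) * 4 ^ DIM('a) / e ^ (DIM('a) - 1)"
      using bound[OF that] e by (simp add: field_simps)
    then show ?thesis
      unfolding B_def by linarith
  qed
  moreover have "P {}"
    by (simp add: P_def)
  ultimately obtain X where X: "P X" and max: "\<And>Y. P Y \<Longrightarrow> card Y \<le> card X"
    using Lattices_Big.ex_has_greatest_nat[of P "{}" card "Suc B"] by blast
  have "sphere 0 1 \<subseteq> (\<Union>x\<in>X. cball x e)"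
  proof (rule ccontr)
    assume "\<not> ?thesis"
    then obtain y where y: "y \<in> sphere 0 1" "\<And>x. x \<in> X \<Longrightarrow> e < dist x y"
      by force
    then have "y \<notin> X"
      using e by force
    have "P (insert y X)"
      using X y unfolding P_def pairwise_insert by (auto simp: dist_commute less_imp_le)
    from max[OF this] show False
      using X \<open>y \<notin> X\<close> by (simp add: P_def)
  qed
  with X bound that show thesis
    unfolding P_def by blast
qed

text \<open>The bound does not depend on \<open>\<delta>\<close>, so it survives the supremum that
  defines the outer measure.\<close>

lemma hausdorff_content_sphere_le:
  assumes "0 < \<delta>"
  shows "hausdorff_content (DIM('a) - 1) \<delta> (sphere (0::'a::euclidean_space) 1)
    \<le> ennreal (unit_ball_vol (DIM('a) - 1) * (real DIM('a) * 4 ^ DIM('a)))"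
proof -
  define k where "k = DIM('a) - 1"
  \<comment> \<open>A ball of radius \<open>e\<close> has diameter \<open>2 * e\<close>, hence the
    \<open>\<delta> / 2\<close>; the cap 1 is required by the packing bound.\<close>
  define e where "e = min 1 (\<delta> / 2)"
  have e: "0 < e" "e \<le> 1" "2 * e \<le> \<delta>"
    using assms by (auto simp: e_def)
  obtain X :: "'a set" where X: "finite X" "real (card X) * e ^ k \<le> real DIM('a) * 4 ^ DIM('a)"
    "sphere 0 1 \<subseteq> (\<Union>x\<in>X. cball x e)"
    using finite_cball_cover_sphere[OF e(1,2)] unfolding k_def by blast
  obtain x where x: "x ` {i::nat. i < card X} = X"
    using finite_imp_nat_seg_image_inj_on[OF X(1)] by (metis card_Collect_less_nat card_image)
  define C where "C i = (if i < card X then cball (x i) e else {})" for i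
  have "sphere 0 1 \<subseteq> (\<Union>i. C i)"
  proof
    fix y :: 'a assume "y \<in> sphere 0 1"
    then obtain w where "w \<in> X" "y \<in> cball w e"
      using X(3) by blast
    moreover from \<open>w \<in> X\<close> obtain i where "w = x i" "i < card X"
      using x by blast
    ultimately have "i < card X" "y \<in> cball (x i) e"
      by simp_all
    then show "y \<in> (\<Union>i. C i)"
      by (auto simp: C_def)
  qed
  moreover have "bounded (C i) \<and> diameter (C i) \<le> \<delta>" for i
    using e assms by (simp add: C_def)
  ultimately have "hausdorff_content k \<delta> (sphere (0::'a) 1) \<le>
      (\<Sum>i. if C i = {} then 0 else ennreal (unit_ball_vol (real k) * (diameter (C i) / 2) ^ k))"
    unfolding hausdorff_content_def by (intro INF_lower) simp
  also have "\<dots> = (\<Sum>i<card X. ennreal (unit_ball_vol (real k) * e ^ k))"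
    using e by (subst suminf_finite[of "{..<card X}"]) (auto simp: C_def)
  also have "\<dots> = ennreal (unit_ball_vol (real k) * (real (card X) * e ^ k))"
    using e by (simp add: ennreal_of_nat_eq_real_of_nat ennreal_mult'[symmetric] mult_ac)
  also have "\<dots> \<le> ennreal (unit_ball_vol (real k) * (real DIM('a) * 4 ^ DIM('a)))"
    using X(2) by (intro ennreal_leI mult_left_mono) auto
  finally show ?thesis
    by (simp add: k_def)
qed

lemma emeasure_hausdorff_measure_sphere_finite:
  "emeasure (hausdorff_measure (DIM('a) - 1)) (sphere (0::'a::euclidean_space) 1) < \<infinity>"
proof -
  have "hausdorff_outer_measure (DIM('a) - 1) (sphere (0::'a) 1)
      \<le> ennreal (unit_ball_vol (DIM('a) - 1) * (real DIM('a) * 4 ^ DIM('a)))"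
    unfolding hausdorff_outer_measure_def using hausdorff_content_sphere_le by (intro SUP_least) auto
  then show ?thesis
    using emeasure_hausdorff_measure_le[of "DIM('a) - 1" "sphere (0::'a) 1"]
    by (metis ennreal_less_top infinity_ennreal_def le_less_trans)
qed

section \<open>Rotation invariant measures on the sphere\<close>

lemma measure_cball_slab_le:
  fixes u :: "'a::euclidean_space"
  assumes u: "norm u = 1" and N: "N > 0"
  shows "measure lborel {z \<in> cball 0 1. \<bar>u \<bullet> z\<bar> \<le> 1 / real N} \<le> measure lborel (cball (0::'a) 4) / real N"
proof -
  define e where "e = 1 / real N"
  have e: "e > 0"
    using N by (simp add: e_def)
  define S where "S = {z \<in> cball 0 1. \<bar>u \<bullet> z\<bar> \<le> e}"
  \<comment> \<open>The slab has width \<open>2 * e\<close>, so shifts by multiples of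
    \<open>3 * e\<close> along \<open>u\<close> are disjoint. As \<open>real k * e \<le> 1\<close>
    for \<open>k < N\<close>, all \<open>N\<close> copies stay within radius 3 + 1 = 4, which
    explains the ball of radius 4.\<close>
  define D where "D k = (+) ((3 * real k * e) *\<^sub>R u) ` S" for k
  have "compact S"
  proof -
    have "closed {z. \<bar>u \<bullet> z\<bar> \<le> e}"
      by (intro closed_Collect_le continuous_intros)
    moreover have "S = cball 0 1 \<inter> {z. \<bar>u \<bullet> z\<bar> \<le> e}"
      by (auto simp: S_def)
    ultimately show ?thesis
      by auto
  qed
  then have comp: "compact (D k)" for k
    unfolding D_def by (rule compact_translation)
  then have meas: "D k \<in> sets lborel" for k
    by (auto intro: borel_compact)
  have fin: "emeasure lborel (D k) \<noteq> \<infinity>" for k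
    using emeasure_bounded_finite[OF compact_imp_bounded[OF comp]] by (metis less_irrefl)
  have inner: "3 * real k * e - e \<le> u \<bullet> z \<and> u \<bullet> z \<le> 3 * real k * e + e" if "z \<in> D k" for z k
    using that u by (auto simp: D_def S_def inner_add_right dot_square_norm)
  have disj: "disjoint_family_on D {..<N}"
    unfolding disjoint_family_on_def
  proof (intro ballI impI)
    have aux: "D i \<inter> D j = {}" if "i < j" for i j
    proof -
      have "real i + 1 \<le> real j"
        using that by linarith
      then have "(real i + 1) * e \<le> real j * e"
        using e by (intro mult_right_mono) auto
      then show ?thesis
        using inner[of _ i] inner[of _ j] e by (fastforce simp: algebra_simps)
    qed
    fix i j :: nat assume "i \<noteq> j"
    then show "D i \<inter> D j = {}"
      using aux[of i j] aux[of j i] by (auto simp: neq_iff)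
  qed
  have "real N * measure lborel S = (\<Sum>k<N. measure lborel (D k))"
  proof -
    have "measure lborel (D k) = measure lborel S" for k
      using measure_translation[of "(3 * real k * e) *\<^sub>R u" S] meas[of k] \<open>compact S\<close>
      by (simp add: D_def borel_compact measure_completion)
    then show ?thesis
      by simp
  qed
  also have "\<dots> = measure lborel (\<Union>k<N. D k)"
    using fin meas disj by (intro measure_finite_Union[symmetric]) auto
  also have "\<dots> \<le> measure lborel (cball (0::'a) 4)"
  proof (rule measure_mono_fmeasurable)
    show "(\<Union>k<N. D k) \<subseteq> cball 0 4"
    proof clarify
      fix k z assume k: "k < N" and "z \<in> D k"
      then obtain w where w: "norm w \<le> 1" "z = (3 * real k * e) *\<^sub>R u + w"
        by (auto simp: D_def S_def)
      have "norm z \<le> 3 * real k * e + norm w"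
        using norm_triangle_ineq[of "(3 * real k * e) *\<^sub>R u" w] u e w by simp
      moreover have "real k * e \<le> 1"
        using k N by (simp add: e_def)
      ultimately show "z \<in> cball 0 4"
        using w by simp
    qed
    show "cball 0 4 \<in> fmeasurable lborel"
      using emeasure_lborel_cball_finite by (auto simp: fmeasurable_def)
  qed (use meas in auto)
  finally show ?thesis
    using N by (simp add: S_def e_def field_simps)
qed

text \<open>The intersection with the sphere makes the invariance axiom match
  \<open>emeasure_distr\<close>, where preimages are taken inside the space of the measure while
  \<open>T\<close> acts on all of the vector space.\<close>

locale invariant_sphere_measure = finite_measure \<sigma> for \<sigma> :: "(real ^ 'n::finite) measure" +
  assumes sets_eq: "sets \<sigma> = sets (restrict_space borel (sphere 0 1))"
    and emeasure_vimage: "orthogonal_transformation T \<Longrightarrow> A \<in> sets \<sigma> \<Longrightarrow>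
      emeasure \<sigma> (T -` A \<inter> sphere 0 1) = emeasure \<sigma> A"
begin

lemma space_eq: "space \<sigma> = sphere 0 1"
  using sets_eq_imp_space_eq[OF sets_eq] by (simp add: space_restrict_space)

lemma borel_measurable_continuous_on_sphere:
  fixes f :: "real ^ 'n \<Rightarrow> 'b::topological_space"
  shows "continuous_on (sphere 0 1) f \<Longrightarrow> f \<in> borel_measurable \<sigma>"
  by (simp add: measurable_cong_sets[OF sets_eq refl] borel_measurable_continuous_on_restrict)

lemma borel_measurable_restrict: "f \<in> borel_measurable borel \<Longrightarrow> f \<in> borel_measurable \<sigma>"
  by (simp add: measurable_cong_sets[OF sets_eq refl] measurable_restrict_space1)

lemma orthogonal_transformation_measurable:
  assumes "orthogonal_transformation T"
  shows "T \<in> measurable \<sigma> \<sigma>"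
proof -
  have "continuous_on UNIV T"
    using assms by (simp add: linear_continuous_on linear_linear orthogonal_transformation_linear)
  then have "T \<in> borel_measurable \<sigma>"
    by (meson borel_measurable_continuous_on_sphere continuous_on_subset subset_UNIV)
  moreover have "T \<in> space \<sigma> \<rightarrow> sphere 0 1"
    using assms by (auto simp: space_eq orthogonal_transformation_norm)
  ultimately have "T \<in> measurable \<sigma> (restrict_space borel (sphere 0 1))"
    by (simp add: measurable_restrict_space2_iff)
  then show ?thesis
    by (simp add: measurable_cong_sets[OF refl sets_eq])
qed

lemma distr_orthogonal_transformation:
  assumes "orthogonal_transformation T"
  shows "distr \<sigma> \<sigma> T = \<sigma>"
proof (rule measure_eqI)
  fix A assume "A \<in> sets (distr \<sigma> \<sigma> T)"
  then show "emeasure (distr \<sigma> \<sigma> T) A = emeasure \<sigma> A"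
    using emeasure_vimage[OF assms, of A]
    by (simp add: emeasure_distr orthogonal_transformation_measurable[OF assms] space_eq)
qed simp

lemma integral_orthogonal_transformation:
  fixes f :: "real ^ 'n \<Rightarrow> real"
  assumes "orthogonal_transformation T" "f \<in> borel_measurable \<sigma>"
  shows "(LINT \<xi>|\<sigma>. f (T \<xi>)) = (LINT \<xi>|\<sigma>. f \<xi>)"
  using integral_distr[OF orthogonal_transformation_measurable[OF assms(1)] assms(2)]
  by (simp add: distr_orthogonal_transformation[OF assms(1)])

lemma band_sets: "{\<xi> \<in> space \<sigma>. \<bar>\<xi> \<bullet> a\<bar> \<le> c} \<in> sets \<sigma>"
proof -
  have [measurable]: "(\<lambda>\<xi>. \<bar>\<xi> \<bullet> a\<bar>) \<in> borel_measurable \<sigma>"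
    by (intro borel_measurable_continuous_on_sphere continuous_intros)
  show ?thesis
    by measurable
qed

text \<open>Orthogonal maps act transitively on unit vectors and carry bands to bands.\<close>

lemma emeasure_band_eq:
  assumes "norm a = 1" "norm b = 1"
  shows "emeasure \<sigma> {\<xi> \<in> space \<sigma>. \<bar>\<xi> \<bullet> a\<bar> \<le> c} = emeasure \<sigma> {\<xi> \<in> space \<sigma>. \<bar>\<xi> \<bullet> b\<bar> \<le> c}"
proof -
  obtain T where T: "orthogonal_transformation T" "T a = b"
    using orthogonal_transformation_exists_1[OF assms] .
  have eq: "T -` {\<xi> \<in> space \<sigma>. \<bar>\<xi> \<bullet> b\<bar> \<le> c} \<inter> sphere 0 1 = {\<xi> \<in> space \<sigma>. \<bar>\<xi> \<bullet> a\<bar> \<le> c}"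
    using T by (auto simp: space_eq orthogonal_transformation_norm orthogonal_transformation_def)
  then show ?thesis
    using emeasure_vimage[OF T(1) band_sets, of b c] by (simp only: eq)
qed

text \<open>Averaging over \<open>a\<close> in the unit ball reduces the estimate to the Lebesgue measure of slabs.\<close>

lemma emeasure_band_le:
  "\<exists>C\<ge>0. \<forall>a N. norm a = 1 \<longrightarrow> N > 0 \<longrightarrow> emeasure \<sigma> {\<xi> \<in> space \<sigma>. \<bar>\<xi> \<bullet> a\<bar> \<le> 1 / real N} \<le> ennreal (C / real N)"
proof -
  define V where "V = measure lborel (cball (0::real^'n) 1)"
  define W where "W = measure lborel (cball (0::real^'n) 4)"
  have V: "V > 0" "emeasure lborel (cball (0::real^'n) 1) = ennreal V"
    using content_cball_pos[of 1 "0::real^'n"] emeasure_lborel_cball_finite[of "0::real^'n" 1]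
    by (simp_all add: V_def emeasure_eq_ennreal_measure)
  have "emeasure \<sigma> {\<xi> \<in> space \<sigma>. \<bar>\<xi> \<bullet> a\<bar> \<le> 1 / real N} \<le> ennreal (W * measure \<sigma> (space \<sigma>) / V / real N)"
    if a: "norm a = 1" and N: "N > 0" for a :: "real^'n" and N
  proof -
    interpret P: pair_sigma_finite \<sigma> "lborel :: (real^'n) measure" ..
    define e where "e = 1 / real N"
    have e: "e > 0"
      using N by (simp add: e_def)
    let ?f = "\<lambda>(\<xi>, z). indicator (cball 0 1) z * indicator {..e} \<bar>\<xi> \<bullet> z\<bar> :: ennreal"
    have id: "(\<lambda>\<xi>. \<xi>) \<in> borel_measurable \<sigma>"
      by (intro borel_measurable_continuous_on_sphere continuous_intros)
    have [measurable]: "(\<lambda>\<xi>. \<bar>\<xi> \<bullet> z\<bar>) \<in> borel_measurable \<sigma>" for z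
      by (intro borel_measurable_continuous_on_sphere continuous_intros)
    have fst_snd: "fst \<in> borel_measurable (\<sigma> \<Otimes>\<^sub>M lborel)" "snd \<in> borel_measurable (\<sigma> \<Otimes>\<^sub>M lborel)"
      using measurable_compose[OF measurable_fst id] by auto
    have "(\<lambda>x. indicator (cball 0 1) (snd x) * indicator {..e} \<bar>fst x \<bullet> snd x\<bar> :: ennreal)
        \<in> borel_measurable (\<sigma> \<Otimes>\<^sub>M lborel)"
      by (intro borel_measurable_times_ennreal fst_snd
          measurable_compose[OF fst_snd(2) borel_measurable_indicator]
          measurable_compose[OF borel_measurable_abs[OF borel_measurable_inner[OF fst_snd]]
            borel_measurable_indicator]) auto
    then have f: "?f \<in> borel_measurable (\<sigma> \<Otimes>\<^sub>M lborel)"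
      by (simp add: case_prod_unfold)
    have "ennreal V * emeasure \<sigma> {\<xi> \<in> space \<sigma>. \<bar>\<xi> \<bullet> a\<bar> \<le> e}
        = (\<integral>\<^sup>+z. emeasure \<sigma> {\<xi> \<in> space \<sigma>. \<bar>\<xi> \<bullet> a\<bar> \<le> e} * indicator (cball (0::real^'n) 1) z \<partial>lborel)"
      by (subst nn_integral_cmult_indicator) (simp_all add: V mult.commute)
    \<comment> \<open>The band of \<open>a\<close> has the measure of the band of
      \<open>z /\<^sub>R norm z\<close>, and the latter is contained in the band of \<open>z\<close>
      because \<open>norm z \<le> 1\<close>. So the constant on the left is a lower bound for every
      \<open>z\<close> in the ball.\<close>
    also have "\<dots> \<le> (\<integral>\<^sup>+z. \<integral>\<^sup>+\<xi>. ?f (\<xi>, z) \<partial>\<sigma> \<partial>lborel)"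
    proof (rule nn_integral_mono)
      fix z :: "real^'n"
      have "emeasure \<sigma> {\<xi> \<in> space \<sigma>. \<bar>\<xi> \<bullet> a\<bar> \<le> e} \<le> emeasure \<sigma> {\<xi> \<in> space \<sigma>. \<bar>\<xi> \<bullet> z\<bar> \<le> e}"
        if z: "norm z \<le> 1"
      proof (cases "z = 0")
        case True
        then show ?thesis
          using e by (intro emeasure_mono band_sets) auto
      next
        case False
        then have "emeasure \<sigma> {\<xi> \<in> space \<sigma>. \<bar>\<xi> \<bullet> a\<bar> \<le> e}
            = emeasure \<sigma> {\<xi> \<in> space \<sigma>. \<bar>\<xi> \<bullet> (z /\<^sub>R norm z)\<bar> \<le> e}"
          by (intro emeasure_band_eq a) simp
        also have "\<dots> \<le> emeasure \<sigma> {\<xi> \<in> space \<sigma>. \<bar>\<xi> \<bullet> z\<bar> \<le> e}"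
        proof (intro emeasure_mono band_sets subsetI, clarify)
          fix \<xi> assume "\<xi> \<in> space \<sigma>" and le: "\<bar>\<xi> \<bullet> (z /\<^sub>R norm z)\<bar> \<le> e"
          have "\<bar>\<xi> \<bullet> z\<bar> = norm z * \<bar>\<xi> \<bullet> (z /\<^sub>R norm z)\<bar>"
            using False by (simp add: abs_mult)
          also have "\<dots> \<le> 1 * e"
            using z le e by (intro mult_mono) auto
          finally show "\<bar>\<xi> \<bullet> z\<bar> \<le> e"
            by simp
        qed
        finally show ?thesis .
      qed
      moreover have "(\<integral>\<^sup>+\<xi>. ?f (\<xi>, z) \<partial>\<sigma>) =
          indicator (cball 0 1) z * emeasure \<sigma> {\<xi> \<in> space \<sigma>. \<bar>\<xi> \<bullet> z\<bar> \<le> e}"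
      proof -
        have "(\<integral>\<^sup>+\<xi>. ?f (\<xi>, z) \<partial>\<sigma>) = indicator (cball 0 1) z * (\<integral>\<^sup>+\<xi>. indicator {..e} \<bar>\<xi> \<bullet> z\<bar> \<partial>\<sigma>)"
          by (simp add: nn_integral_cmult)
        also have "(\<integral>\<^sup>+\<xi>. indicator {..e} \<bar>\<xi> \<bullet> z\<bar> \<partial>\<sigma>) =
            (\<integral>\<^sup>+\<xi>. indicator {\<xi> \<in> space \<sigma>. \<bar>\<xi> \<bullet> z\<bar> \<le> e} \<xi> \<partial>\<sigma>)"
          by (intro nn_integral_cong) (auto simp: indicator_def)
        finally show ?thesis
          by (simp add: nn_integral_indicator[OF band_sets])
      qed
      ultimately show "emeasure \<sigma> {\<xi> \<in> space \<sigma>. \<bar>\<xi> \<bullet> a\<bar> \<le> e} * indicator (cball 0 1) z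
          \<le> (\<integral>\<^sup>+\<xi>. ?f (\<xi>, z) \<partial>\<sigma>)"
        by (auto simp: indicator_def)
    qed
    \<comment> \<open>After exchanging the integrals, the inner one is the Lebesgue measure of a
      slab orthogonal to the unit vector \<open>\<xi>\<close>, for which the \<open>1 / N\<close>
      bound is known.\<close>
    also have "\<dots> = (\<integral>\<^sup>+\<xi>. \<integral>\<^sup>+z. ?f (\<xi>, z) \<partial>lborel \<partial>\<sigma>)"
      by (rule P.Fubini[OF f])
    also have "\<dots> \<le> (\<integral>\<^sup>+\<xi>. ennreal (W / real N) \<partial>\<sigma>)"
    proof (rule nn_integral_mono)
      fix \<xi> assume "\<xi> \<in> space \<sigma>"
      then have \<xi>: "norm \<xi> = 1"
        by (simp add: space_eq)
      have "(\<integral>\<^sup>+z. ?f (\<xi>, z) \<partial>lborel) = (\<integral>\<^sup>+z. indicator {z \<in> cball 0 1. \<bar>\<xi> \<bullet> z\<bar> \<le> e} z \<partial>lborel)"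
        by (intro nn_integral_cong) (auto simp: indicator_def)
      also have "\<dots> = emeasure lborel {z \<in> cball 0 1. \<bar>\<xi> \<bullet> z\<bar> \<le> e}"
        by (rule nn_integral_indicator) measurable
      also have "\<dots> = ennreal (measure lborel {z \<in> cball 0 1. \<bar>\<xi> \<bullet> z\<bar> \<le> e})"
      proof (rule emeasure_eq_ennreal_measure)
        have "emeasure lborel {z \<in> cball 0 1. \<bar>\<xi> \<bullet> z\<bar> \<le> e} < \<infinity>"
          by (rule emeasure_bounded_finite[OF bounded_subset[OF bounded_cball[of 0 1]]]) auto
        then show "emeasure lborel {z \<in> cball 0 1. \<bar>\<xi> \<bullet> z\<bar> \<le> e} \<noteq> top"
          by auto
      qed
      also have "\<dots> \<le> ennreal (W / real N)"
        using measure_cball_slab_le[OF \<xi> N] by (intro ennreal_leI) (simp add: e_def W_def)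
      finally show "(\<integral>\<^sup>+z. ?f (\<xi>, z) \<partial>lborel) \<le> ennreal (W / real N)" .
    qed
    also have "\<dots> = ennreal (W * measure \<sigma> (space \<sigma>) / real N)"
      by (simp add: emeasure_eq_measure ennreal_mult[symmetric] W_def mult_ac)
    finally have "ennreal V * ennreal (measure \<sigma> {\<xi> \<in> space \<sigma>. \<bar>\<xi> \<bullet> a\<bar> \<le> e})
        \<le> ennreal (W * measure \<sigma> (space \<sigma>) / real N)"
      by (simp add: emeasure_eq_measure)
    then have "V * measure \<sigma> {\<xi> \<in> space \<sigma>. \<bar>\<xi> \<bullet> a\<bar> \<le> e} \<le> W * measure \<sigma> (space \<sigma>) / real N"
      using V(1) by (simp add: W_def ennreal_mult[symmetric])
    then have "measure \<sigma> {\<xi> \<in> space \<sigma>. \<bar>\<xi> \<bullet> a\<bar> \<le> e} \<le> W * measure \<sigma> (space \<sigma>) / real N / V"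
      using V(1) by (simp only: pos_le_divide_eq mult.commute[of _ V])
    then have "measure \<sigma> {\<xi> \<in> space \<sigma>. \<bar>\<xi> \<bullet> a\<bar> \<le> e} \<le> W * measure \<sigma> (space \<sigma>) / V / real N"
      by (simp add: mult.commute)
    then show ?thesis
      unfolding emeasure_eq_measure e_def by (rule ennreal_leI)
  qed
  moreover have "W * measure \<sigma> (space \<sigma>) / V \<ge> 0"
    using V(1) by (simp add: W_def)
  ultimately show ?thesis
    by blast
qed

text \<open>The great sphere orthogonal to \<open>a\<close> lies in every band, and the measures of
  the bands tend to 0.\<close>

lemma AE_inner_nonzero:
  assumes a: "norm a = 1"
  shows "AE \<xi> in \<sigma>. \<xi> \<bullet> a \<noteq> 0"
proof -
  obtain C where C: "C \<ge> 0"
    "\<And>N. N > 0 \<Longrightarrow> emeasure \<sigma> {\<xi> \<in> space \<sigma>. \<bar>\<xi> \<bullet> a\<bar> \<le> 1 / real N} \<le> ennreal (C / real N)"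
    using emeasure_band_le a by blast
  let ?Z = "{\<xi> \<in> space \<sigma>. \<bar>\<xi> \<bullet> a\<bar> \<le> 0}"
  have "measure \<sigma> ?Z \<le> C / real (Suc N)" for N
  proof -
    have "emeasure \<sigma> ?Z \<le> emeasure \<sigma> {\<xi> \<in> space \<sigma>. \<bar>\<xi> \<bullet> a\<bar> \<le> 1 / real (Suc N)}"
      by (intro emeasure_mono band_sets) auto
    also have "\<dots> \<le> ennreal (C / real (Suc N))"
      by (rule C(2)) simp
    finally show ?thesis
      using C(1) by (simp add: emeasure_eq_measure)
  qed
  moreover have "(\<lambda>N. C / real (Suc N)) \<longlonglongrightarrow> 0"
    by (rule LIMSEQ_Suc[OF lim_const_over_n])
  ultimately have "measure \<sigma> ?Z \<le> 0"
    by (intro LIMSEQ_le_const) auto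
  then have "emeasure \<sigma> ?Z = 0"
    by (simp add: emeasure_eq_measure measure_le_0_iff)
  then have "?Z \<in> null_sets \<sigma>"
    by (intro null_setsI band_sets)
  then show ?thesis
    by (rule AE_I') auto
qed

text \<open>A dyadic layer argument: \<open>\<bar>ln s\<bar>\<close> is at most the number of
  indices j with \<open>s \<le> 1 / 2 ^ j\<close>, and the measures of these bands are dominated by
  a geometric series.\<close>

lemma integrable_ln_inner:
  assumes a: "norm a = 1"
  shows "integrable \<sigma> (\<lambda>\<xi>. ln \<bar>\<xi> \<bullet> a\<bar>)"
proof -
  obtain C where C: "C \<ge> 0"
    "\<And>N. N > 0 \<Longrightarrow> emeasure \<sigma> {\<xi> \<in> space \<sigma>. \<bar>\<xi> \<bullet> a\<bar> \<le> 1 / real N} \<le> ennreal (C / real N)"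
    using emeasure_band_le a by blast
  let ?S = "\<lambda>j. {\<xi> \<in> space \<sigma>. \<bar>\<xi> \<bullet> a\<bar> \<le> 1 / real (2 ^ j)}"
  have bound: "ennreal \<bar>ln \<bar>\<xi> \<bullet> a\<bar>\<bar> \<le> (\<Sum>j. indicator (?S j) \<xi>)" if "\<xi> \<in> space \<sigma>" for \<xi>
  proof (cases "\<xi> \<bullet> a = 0")
    case False
    define s where "s = \<bar>\<xi> \<bullet> a\<bar>"
    have s: "0 < s" "s \<le> 1"
      using False that a Cauchy_Schwarz_ineq2[of \<xi> a] by (auto simp: s_def space_eq)
    define k where "k = nat \<lceil>- ln s\<rceil>"
    have k: "- ln s \<le> real k" "real k < 1 - ln s"
    proof -
      have "0 \<le> - ln s"
        using s by simp
      then show "- ln s \<le> real k" "real k < 1 - ln s"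
        unfolding k_def by linarith+
    qed
    \<comment> \<open>For \<open>j < k\<close> one has \<open>j \<le> k - 1 < - ln s\<close>, and
      \<open>ln 2 < 1\<close> turns this into \<open>2 ^ j \<le> 1 / s\<close>. Thus at least
      \<open>k\<close> of the bands contain \<open>\<xi>\<close>.\<close>
    have mem: "\<xi> \<in> ?S j" if "j < k" for j
    proof -
      have "real j * ln 2 \<le> real j * 1"
        using ln_2_less_1 by (intro mult_left_mono) auto
      moreover have "real j + 1 \<le> real k"
        using \<open>j < k\<close> by linarith
      ultimately have "real j * ln 2 \<le> - ln s"
        using k by linarith
      then have "ln (2 ^ j) \<le> ln (1 / s)"
        using s by (simp add: ln_realpow ln_div)
      then have "2 ^ j \<le> 1 / s"
        using s by (subst (asm) ln_le_cancel_iff) auto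
      then have "s \<le> 1 / real (2 ^ j)"
        using s by (simp add: field_simps)
      then show ?thesis
        using \<open>\<xi> \<in> space \<sigma>\<close> by (simp add: s_def)
    qed
    have "ennreal \<bar>ln s\<bar> \<le> ennreal (real k)"
      using k s by (intro ennreal_leI) auto
    also have "\<dots> = (\<Sum>j<k. indicator (?S j) \<xi>)"
      using mem by (simp add: ennreal_of_nat_eq_real_of_nat)
    also have "\<dots> \<le> (\<Sum>j. indicator (?S j) \<xi>)"
      by (rule sum_le_suminf) auto
    finally show ?thesis
      by (simp add: s_def)
  qed simp
  have "(\<integral>\<^sup>+\<xi>. ennreal (norm (ln \<bar>\<xi> \<bullet> a\<bar>)) \<partial>\<sigma>) \<le> (\<integral>\<^sup>+\<xi>. (\<Sum>j. indicator (?S j) \<xi>) \<partial>\<sigma>)"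
    using bound by (intro nn_integral_mono) simp
  also have "\<dots> = (\<Sum>j. emeasure \<sigma> (?S j))"
    by (subst nn_integral_suminf) (simp_all only: nn_integral_indicator[OF band_sets] borel_measurable_indicator[OF band_sets])
  also have "\<dots> \<le> (\<Sum>j. ennreal (C * (1 / 2) ^ j))"
  proof (rule suminf_le)
    show "emeasure \<sigma> (?S j) \<le> ennreal (C * (1 / 2) ^ j)" for j
      using C(2)[of "2 ^ j"] by (simp add: power_one_over)
  qed auto
  also have "\<dots> = ennreal (\<Sum>j. C * (1 / 2) ^ j)"
    using C(1) by (intro suminf_ennreal2) (auto intro: summable_mult summable_geometric)
  also have "\<dots> < \<infinity>"
    by simp
  finally have "(\<integral>\<^sup>+\<xi>. ennreal (norm (ln \<bar>\<xi> \<bullet> a\<bar>)) \<partial>\<sigma>) < \<infinity>" .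
  moreover have "(\<lambda>\<xi>. ln \<bar>\<xi> \<bullet> a\<bar>) \<in> borel_measurable \<sigma>"
    by (intro borel_measurable_restrict) measurable
  ultimately show ?thesis
    by (simp add: integrable_iff_bounded)
qed

lemma integrable_ln_inner_mult:
  fixes h :: "real ^ 'n \<Rightarrow> real"
  assumes a: "norm a = 1" and h: "continuous_on (sphere 0 1) h"
  shows "integrable \<sigma> (\<lambda>\<xi>. ln \<bar>\<xi> \<bullet> a\<bar> * h \<xi>)"
proof -
  have "compact (h ` sphere 0 1)"
    by (intro compact_continuous_image h compact_sphere)
  then obtain B where B: "\<forall>\<xi>\<in>sphere 0 1. \<bar>h \<xi>\<bar> \<le> B"
    using compact_imp_bounded[of "h ` sphere 0 1"] by (auto simp: bounded_iff)
  have [measurable]: "h \<in> borel_measurable \<sigma>"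
    by (rule borel_measurable_continuous_on_sphere[OF h])
  have [measurable]: "(\<lambda>\<xi>. ln \<bar>\<xi> \<bullet> a\<bar>) \<in> borel_measurable \<sigma>"
    using integrable_ln_inner[OF a] by auto
  show ?thesis
  proof (rule Bochner_Integration.integrable_bound[of _ "\<lambda>\<xi>. B * ln \<bar>\<xi> \<bullet> a\<bar>"])
    show "integrable \<sigma> (\<lambda>\<xi>. B * ln \<bar>\<xi> \<bullet> a\<bar>)"
      using integrable_ln_inner[OF a] by simp
    show "AE \<xi> in \<sigma>. norm (ln \<bar>\<xi> \<bullet> a\<bar> * h \<xi>) \<le> norm (B * ln \<bar>\<xi> \<bullet> a\<bar>)"
    proof (rule AE_I2)
      fix \<xi> assume "\<xi> \<in> space \<sigma>"
      then have "\<bar>h \<xi>\<bar> \<le> \<bar>B\<bar>"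
        using B by (force simp: space_eq)
      then show "norm (ln \<bar>\<xi> \<bullet> a\<bar> * h \<xi>) \<le> norm (B * ln \<bar>\<xi> \<bullet> a\<bar>)"
        by (simp add: abs_mult mult.commute[of "\<bar>ln \<bar>\<xi> \<bullet> a\<bar>\<bar>"] mult_right_mono)
    qed
  qed measurable
qed

end

section \<open>Plane rotations and the logarithmic potential\<close>

text \<open>Rotation by \<open>\<theta>\<close> in the plane of the orthonormal pair
  \<open>a\<close>, \<open>b\<close>, identity on the orthogonal complement. The explicit formula
  makes the dependence on \<open>\<theta>\<close> directly differentiable.\<close>

definition plane_rotation :: "'a::real_inner \<Rightarrow> 'a \<Rightarrow> real \<Rightarrow> 'a \<Rightarrow> 'a" where
  "plane_rotation a b \<theta> \<xi> = \<xi> + (cos \<theta> - 1) *\<^sub>R ((\<xi> \<bullet> a) *\<^sub>R a + (\<xi> \<bullet> b) *\<^sub>R b)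
     + sin \<theta> *\<^sub>R ((\<xi> \<bullet> a) *\<^sub>R b - (\<xi> \<bullet> b) *\<^sub>R a)"

text \<open>The infinitesimal generator of \<open>plane_rotation a b\<close>, an antisymmetric
  linear map.\<close>

definition rotation_field :: "'a::real_inner \<Rightarrow> 'a \<Rightarrow> 'a \<Rightarrow> 'a" where
  "rotation_field a b \<xi> = (\<xi> \<bullet> a) *\<^sub>R b - (\<xi> \<bullet> b) *\<^sub>R a"

lemma orthogonal_transformation_plane_rotation:
  assumes a: "norm a = 1" and b: "norm b = 1" and ab: "a \<bullet> b = 0"
  shows "orthogonal_transformation (plane_rotation a b \<theta>)"
  unfolding orthogonal_transformation_def
proof (intro conjI allI)
  show "linear (plane_rotation a b \<theta>)"
    by (rule linearI) (simp_all add: plane_rotation_def inner_add_left algebra_simps)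
  fix v w
  have aa: "a \<bullet> a = 1" "b \<bullet> b = 1" "b \<bullet> a = 0"
    using a b ab by (simp_all add: dot_square_norm inner_commute)
  have sc: "cos \<theta> * cos \<theta> = 1 - sin \<theta> * sin \<theta>"
    using sin_cos_squared_add[of \<theta>] by (simp add: power2_eq_square)
  define c s where "c = cos \<theta>" and "s = sin \<theta>"
  have "plane_rotation a b \<theta> v \<bullet> plane_rotation a b \<theta> w - v \<bullet> w =
      (c * c + s * s - 1) * ((v \<bullet> a) * (w \<bullet> a) + (v \<bullet> b) * (w \<bullet> b))"
    unfolding plane_rotation_def c_def[symmetric] s_def[symmetric]
    by (simp add: inner_add_left inner_add_right inner_diff_left inner_diff_right aa ab
        inner_commute[of a v] inner_commute[of b v] inner_commute[of a w] inner_commute[of b w] algebra_simps)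
  then show "plane_rotation a b \<theta> v \<bullet> plane_rotation a b \<theta> w = v \<bullet> w"
    by (simp add: sc c_def s_def)
qed

lemma plane_rotation_0 [simp]: "plane_rotation a b 0 \<xi> = \<xi>"
  by (simp add: plane_rotation_def)

lemma plane_rotation_first:
  assumes "norm a = 1" "a \<bullet> b = 0"
  shows "plane_rotation a b \<theta> a = cos \<theta> *\<^sub>R a + sin \<theta> *\<^sub>R b"
  using assms by (simp add: plane_rotation_def dot_square_norm algebra_simps)

lemma plane_rotation_has_vector_derivative:
  assumes a: "norm a = 1" and b: "norm b = 1" and ab: "a \<bullet> b = 0"
  shows "((\<lambda>\<theta>. plane_rotation a b \<theta> \<xi>) has_vector_derivative
    rotation_field a b (plane_rotation a b \<theta> \<xi>)) (at \<theta>)"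
proof -
  have aa: "a \<bullet> a = 1" "b \<bullet> b = 1" "b \<bullet> a = 0"
    using a b ab by (simp_all add: dot_square_norm inner_commute)
  have eq: "rotation_field a b (plane_rotation a b \<theta> \<xi>) =
      (- sin \<theta>) *\<^sub>R ((\<xi> \<bullet> a) *\<^sub>R a + (\<xi> \<bullet> b) *\<^sub>R b) + cos \<theta> *\<^sub>R ((\<xi> \<bullet> a) *\<^sub>R b - (\<xi> \<bullet> b) *\<^sub>R a)"
    unfolding rotation_field_def plane_rotation_def
    by (simp add: inner_add_left inner_diff_left aa ab algebra_simps)
  show ?thesis
    unfolding eq unfolding plane_rotation_def
    by (auto intro!: derivative_eq_intros simp: has_real_derivative_iff_has_vector_derivative[symmetric])
qed

text \<open>On the plane of \<open>a\<close> and \<open>b\<close> the generator is a quarter turn,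
  so its square is minus the orthogonal projection onto that plane.\<close>

lemma rotation_field_iterate:
  assumes "norm a = 1" "norm b = 1" "a \<bullet> b = 0"
  shows "rotation_field a b (rotation_field a b \<xi>) = - ((\<xi> \<bullet> a) *\<^sub>R a + (\<xi> \<bullet> b) *\<^sub>R b)"
  using assms unfolding rotation_field_def
  by (simp add: inner_diff_left inner_commute[of b a] dot_square_norm)

context invariant_sphere_measure
begin

text \<open>Differentiation under the integral sign. It is stated for a general pair
  \<open>h\<close>, \<open>k\<close> so that it can be applied twice, to the function and to its
  derivative along the rotation.\<close>

lemma has_real_derivative_integral_ln_rotation:
  fixes h k :: "real ^ 'n \<Rightarrow> real"
  assumes a: "norm a = 1" and b: "norm b = 1" and ab: "a \<bullet> b = 0"
    and h: "continuous_on (sphere 0 1) h" and k: "continuous_on (sphere 0 1) k"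
    and hk: "\<And>\<xi> \<theta>. norm \<xi> = 1 \<Longrightarrow> ((\<lambda>\<theta>. h (plane_rotation a b \<theta> \<xi>)) has_real_derivative
      k (plane_rotation a b \<theta> \<xi>)) (at \<theta>)"
  shows "((\<lambda>\<theta>. LINT \<xi>|\<sigma>. ln \<bar>\<xi> \<bullet> a\<bar> * h (plane_rotation a b \<theta> \<xi>)) has_real_derivative
    (LINT \<xi>|\<sigma>. ln \<bar>\<xi> \<bullet> a\<bar> * k (plane_rotation a b \<theta> \<xi>))) (at \<theta>)"
proof -
  let ?R = "plane_rotation a b"
  let ?l = "\<lambda>\<xi>::real^'n. ln \<bar>\<xi> \<bullet> a\<bar>"
  have ortho: "orthogonal_transformation (?R t)" for t
    by (rule orthogonal_transformation_plane_rotation[OF a b ab])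
  have norm_R: "norm (?R t \<xi>) = norm \<xi>" for t \<xi>
    by (rule orthogonal_transformation_norm[OF ortho])
  have cont: "continuous_on (sphere 0 1) (\<lambda>\<xi>. f (?R t \<xi>))" if "continuous_on (sphere 0 1) f"
    for f :: "real^'n \<Rightarrow> real" and t
  proof (rule continuous_on_compose2[OF that])
    show "continuous_on (sphere 0 1) (?R t)"
      unfolding plane_rotation_def by (intro continuous_intros)
  qed (auto simp: norm_R)
  have "compact (k ` sphere 0 1)"
    by (intro compact_continuous_image k compact_sphere)
  then obtain B where "\<forall>\<xi>\<in>sphere 0 1. \<bar>k \<xi>\<bar> \<le> B"
    using compact_imp_bounded[of "k ` sphere 0 1"] by (auto simp: bounded_iff)
  then have B: "\<bar>k (?R t \<xi>)\<bar> \<le> B" if "norm \<xi> = 1" for t \<xi>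
    using that by (simp add: norm_R)
  have int: "integrable \<sigma> (\<lambda>\<xi>. ?l \<xi> * f (?R t \<xi>))" if "continuous_on (sphere 0 1) f" for f t
    by (rule integrable_ln_inner_mult[OF a cont[OF that]])
  have [measurable]: "?l \<in> borel_measurable \<sigma>"
    using integrable_ln_inner[OF a] by auto
  show ?thesis
    \<comment> \<open>The limit is tested along sequences because dominated convergence is
      formulated for sequences.\<close>
    unfolding has_field_derivative_iff tendsto_at_iff_sequentially comp_def
  proof (intro allI impI)
    fix X :: "nat \<Rightarrow> real"
    assume X: "\<forall>i. X i \<in> UNIV - {\<theta>}" "X \<longlonglongrightarrow> \<theta>"
    have "(\<lambda>i. LINT \<xi>|\<sigma>. ?l \<xi> * ((h (?R (X i) \<xi>) - h (?R \<theta> \<xi>)) / (X i - \<theta>))) \<longlonglongrightarrow>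
        (LINT \<xi>|\<sigma>. ?l \<xi> * k (?R \<theta> \<xi>))"
    proof (rule integral_dominated_convergence[where w = "\<lambda>\<xi>. \<bar>?l \<xi>\<bar> * B"])
      have [measurable]: "(\<lambda>\<xi>. h (?R t \<xi>)) \<in> borel_measurable \<sigma>"
          "(\<lambda>\<xi>. k (?R t \<xi>)) \<in> borel_measurable \<sigma>" for t
        by (intro borel_measurable_continuous_on_sphere cont h k)+
      show "(\<lambda>\<xi>. ?l \<xi> * k (?R \<theta> \<xi>)) \<in> borel_measurable \<sigma>"
        by measurable
      show "(\<lambda>\<xi>. ?l \<xi> * ((h (?R (X i) \<xi>) - h (?R \<theta> \<xi>)) / (X i - \<theta>))) \<in> borel_measurable \<sigma>" for i
        by measurable
      show "integrable \<sigma> (\<lambda>\<xi>. \<bar>?l \<xi>\<bar> * B)"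
        using integrable_ln_inner[OF a] by simp
      show "AE \<xi> in \<sigma>. (\<lambda>i. ?l \<xi> * ((h (?R (X i) \<xi>) - h (?R \<theta> \<xi>)) / (X i - \<theta>))) \<longlonglongrightarrow> ?l \<xi> * k (?R \<theta> \<xi>)"
      proof (rule AE_I2)
        fix \<xi> assume "\<xi> \<in> space \<sigma>"
        then have "norm \<xi> = 1"
          by (simp add: space_eq)
        from hk[OF this, of \<theta>] X
        have "(\<lambda>i. (h (?R (X i) \<xi>) - h (?R \<theta> \<xi>)) / (X i - \<theta>)) \<longlonglongrightarrow> k (?R \<theta> \<xi>)"
          unfolding has_field_derivative_iff tendsto_at_iff_sequentially comp_def by blast
        then show "(\<lambda>i. ?l \<xi> * ((h (?R (X i) \<xi>) - h (?R \<theta> \<xi>)) / (X i - \<theta>))) \<longlonglongrightarrow> ?l \<xi> * k (?R \<theta> \<xi>)"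
          by (rule tendsto_mult_left)
      qed
      show "AE \<xi> in \<sigma>. norm (?l \<xi> * ((h (?R (X i) \<xi>) - h (?R \<theta> \<xi>)) / (X i - \<theta>))) \<le> \<bar>?l \<xi>\<bar> * B" for i
      proof (rule AE_I2)
        fix \<xi> assume "\<xi> \<in> space \<sigma>"
        then have \<xi>: "norm \<xi> = 1"
          by (simp add: space_eq)
        \<comment> \<open>By the mean value inequality the difference quotients are bounded by the
          maximum of \<open>k\<close> on the sphere, uniformly in \<open>\<xi>\<close> and
          \<open>i\<close>; this provides the integrable majorant.\<close>
        have "norm (h (?R (X i) \<xi>) - h (?R \<theta> \<xi>)) \<le> B * norm (X i - \<theta>)"
        proof (rule field_differentiable_bound[of UNIV "\<lambda>t. h (?R t \<xi>)" "\<lambda>t. k (?R t \<xi>)"])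
          show "((\<lambda>t. h (?R t \<xi>)) has_field_derivative k (?R t \<xi>)) (at t within UNIV)" for t
            by (rule hk[OF \<xi>])
        qed (use B[OF \<xi>] in auto)
        then have "\<bar>(h (?R (X i) \<xi>) - h (?R \<theta> \<xi>)) / (X i - \<theta>)\<bar> \<le> B"
          using X(1) by (auto simp: field_simps abs_divide)
        then show "norm (?l \<xi> * ((h (?R (X i) \<xi>) - h (?R \<theta> \<xi>)) / (X i - \<theta>))) \<le> \<bar>?l \<xi>\<bar> * B"
          unfolding real_norm_def abs_mult by (intro mult_left_mono) auto
      qed
    qed
    moreover have "(LINT \<xi>|\<sigma>. ?l \<xi> * ((h (?R (X i) \<xi>) - h (?R \<theta> \<xi>)) / (X i - \<theta>))) =
        ((LINT \<xi>|\<sigma>. ?l \<xi> * h (?R (X i) \<xi>)) - (LINT \<xi>|\<sigma>. ?l \<xi> * h (?R \<theta> \<xi>))) / (X i - \<theta>)" for i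
    proof -
      have "(LINT \<xi>|\<sigma>. ?l \<xi> * ((h (?R (X i) \<xi>) - h (?R \<theta> \<xi>)) / (X i - \<theta>))) =
          (LINT \<xi>|\<sigma>. (?l \<xi> * h (?R (X i) \<xi>) - ?l \<xi> * h (?R \<theta> \<xi>)) / (X i - \<theta>))"
        by (simp add: algebra_simps)
      then show ?thesis
        by (simp add: Bochner_Integration.integral_diff[OF int[OF h] int[OF h]])
    qed
    ultimately show "(\<lambda>i. ((LINT \<xi>|\<sigma>. ?l \<xi> * h (?R (X i) \<xi>)) - (LINT \<xi>|\<sigma>. ?l \<xi> * h (?R \<theta> \<xi>))) / (X i - \<theta>))
        \<longlonglongrightarrow> (LINT \<xi>|\<sigma>. ?l \<xi> * k (?R \<theta> \<xi>))"
      by (simp only:)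
  qed
qed

definition log_potential :: "(real ^ 'n \<Rightarrow> real) \<Rightarrow> real ^ 'n \<Rightarrow> real" where
  "log_potential g z = (LINT \<xi>|\<sigma>. ln \<bar>z \<bullet> \<xi>\<bar> * g \<xi>)"

lemma log_potential_polar:
  assumes a: "norm a = 1" and b: "norm b = 1" and ab: "a \<bullet> b = 0"
    and g: "continuous_on (sphere 0 1) g" and r: "r > 0"
    and z: "z = r *\<^sub>R (cos \<theta> *\<^sub>R a + sin \<theta> *\<^sub>R b)"
  shows "log_potential g z =
    ln r * (LINT \<xi>|\<sigma>. g \<xi>) + (LINT \<xi>|\<sigma>. ln \<bar>\<xi> \<bullet> a\<bar> * g (plane_rotation a b \<theta> \<xi>))"
proof -
  let ?R = "plane_rotation a b \<theta>"
  have ortho: "orthogonal_transformation ?R"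
    by (rule orthogonal_transformation_plane_rotation[OF a b ab])
  define u where "u = ?R a"
  have z: "z = r *\<^sub>R u"
    by (simp add: z u_def plane_rotation_first[OF a ab])
  have u: "norm u = 1"
    using a by (simp add: u_def orthogonal_transformation_norm[OF ortho])
  have intg: "integrable \<sigma> g"
  proof -
    have "compact (g ` sphere 0 1)"
      by (intro compact_continuous_image g compact_sphere)
    then obtain B where "\<forall>\<xi>\<in>sphere 0 1. \<bar>g \<xi>\<bar> \<le> B"
      using compact_imp_bounded[of "g ` sphere 0 1"] by (auto simp: bounded_iff)
    then show ?thesis
      by (intro integrable_const_bound[of _ B] AE_I2 borel_measurable_continuous_on_sphere[OF g])
        (auto simp: space_eq)
  qed
  have int: "integrable \<sigma> (\<lambda>\<xi>. ln \<bar>\<xi> \<bullet> u\<bar> * g \<xi>)"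
    by (rule integrable_ln_inner_mult[OF u g])
  have "log_potential g z = (LINT \<xi>|\<sigma>. ln r * g \<xi> + ln \<bar>\<xi> \<bullet> u\<bar> * g \<xi>)"
    unfolding log_potential_def
  proof (rule integral_cong_AE)
    have [measurable]: "g \<in> borel_measurable \<sigma>"
      by (rule borel_measurable_continuous_on_sphere[OF g])
    have "(\<lambda>\<xi>. ln \<bar>z \<bullet> \<xi>\<bar>) \<in> borel_measurable \<sigma>"
      by (intro borel_measurable_restrict) measurable
    then show "(\<lambda>\<xi>. ln \<bar>z \<bullet> \<xi>\<bar> * g \<xi>) \<in> borel_measurable \<sigma>"
      by measurable
    show "(\<lambda>\<xi>. ln r * g \<xi> + ln \<bar>\<xi> \<bullet> u\<bar> * g \<xi>) \<in> borel_measurable \<sigma>"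
      using int by measurable
    \<comment> \<open>The splitting of the logarithm fails where
      \<open>\<xi> \<bullet> u = 0\<close>, since \<open>ln 0 = 0\<close>; hence only almost
      everywhere.\<close>
    show "AE \<xi> in \<sigma>. ln \<bar>z \<bullet> \<xi>\<bar> * g \<xi> = ln r * g \<xi> + ln \<bar>\<xi> \<bullet> u\<bar> * g \<xi>"
      using AE_inner_nonzero[OF u]
    proof eventually_elim
      case (elim \<xi>)
      then show ?case
        using r by (simp add: z abs_mult ln_mult inner_commute[of u] algebra_simps)
    qed
  qed
  also have "\<dots> = ln r * (LINT \<xi>|\<sigma>. g \<xi>) + (LINT \<xi>|\<sigma>. ln \<bar>\<xi> \<bullet> u\<bar> * g \<xi>)"
    using intg int by simp
  \<comment> \<open>The substitution by \<open>?R\<close> undoes the rotation inside the logarithm,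
    as \<open>u = ?R a\<close> and \<open>?R\<close> preserves inner products, and moves it into
    \<open>g\<close>.\<close>
  also have "(LINT \<xi>|\<sigma>. ln \<bar>\<xi> \<bullet> u\<bar> * g \<xi>) = (LINT \<xi>|\<sigma>. ln \<bar>?R \<xi> \<bullet> u\<bar> * g (?R \<xi>))"
    using integral_orthogonal_transformation[OF ortho, of "\<lambda>\<xi>. ln \<bar>\<xi> \<bullet> u\<bar> * g \<xi>"] int by auto
  also have "\<dots> = (LINT \<xi>|\<sigma>. ln \<bar>\<xi> \<bullet> a\<bar> * g (?R \<xi>))"
    using ortho by (simp add: u_def orthogonal_transformation_def)
  finally show ?thesis .
qed

end

section \<open>Second derivatives of the potential along a line, in polar coordinates\<close>

lemma deriv_deriv_eqI:
  fixes f :: "real \<Rightarrow> real"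
  assumes "e > 0" "\<And>t. \<bar>t\<bar> < e \<Longrightarrow> (f has_real_derivative f' t) (at t)"
    and "(f' has_real_derivative D) (at 0)"
  shows "deriv (deriv f) 0 = D"
proof (rule DERIV_imp_deriv)
  have "deriv f t = f' t" if "\<bar>t\<bar> < e" for t
    by (rule DERIV_imp_deriv[OF assms(2)[OF that]])
  then have "eventually (\<lambda>t. deriv f t = f' t) (nhds 0)"
    using assms(1) by (auto simp: eventually_nhds_metric dist_real_def)
  then show "(deriv f has_real_derivative D) (at 0)"
    using assms(3) DERIV_cong_ev by blast
qed

text \<open>In polar coordinates the line \<open>t \<mapsto> \<rho> a + t (d a + c b)\<close> has radius
  \<open>sqrt ((\<rho> + t d)\<^sup>2 + (t c)\<^sup>2)\<close> and angle \<open>arctan (t c / (\<rho> + t d))\<close>.\<close>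

lemma deriv_deriv_polar_line:
  fixes f \<Phi> \<Psi> X :: "real \<Rightarrow> real"
  assumes \<rho>: "\<rho> > 0" and cd: "c\<^sup>2 + d\<^sup>2 = 1"
    and \<Phi>: "\<And>\<theta>. (\<Phi> has_real_derivative \<Psi> \<theta>) (at \<theta>)"
    and \<Psi>: "\<And>\<theta>. (\<Psi> has_real_derivative X \<theta>) (at \<theta>)"
    and f: "\<And>t. \<bar>t\<bar> < \<rho> \<Longrightarrow>
      f t = ln (sqrt ((\<rho> + t * d)\<^sup>2 + (t * c)\<^sup>2)) * I + \<Phi> (arctan (t * c / (\<rho> + t * d)))"
  shows "deriv (deriv f) 0 = ((1 - 2 * d\<^sup>2) * I + c\<^sup>2 * X 0 - 2 * c * d * \<Psi> 0) / \<rho>\<^sup>2"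
proof -
  define N where "N t = (\<rho> + t * d)\<^sup>2 + (t * c)\<^sup>2" for t
  have "d\<^sup>2 \<le> 1"
    using cd zero_le_power2[of c] by linarith
  then have d: "\<bar>d\<bar> \<le> 1"
    by (simp add: abs_square_le_1)
  have pos: "\<rho> + t * d > 0" if "\<bar>t\<bar> < \<rho>" for t
  proof -
    have "\<bar>t * d\<bar> \<le> \<bar>t\<bar> * 1"
      unfolding abs_mult using d by (intro mult_left_mono) auto
    then show ?thesis
      using that by linarith
  qed
  have N: "N t > 0" if "\<bar>t\<bar> < \<rho>" for t
    using pos[OF that] by (simp add: N_def add_pos_nonneg)
  have dN: "(N has_real_derivative 2 * (\<rho> * d + t)) (at t)" for t
  proof -
    have "(N has_real_derivative 2 * (\<rho> + t * d) * d + 2 * (t * c) * c) (at t)"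
      unfolding N_def by (auto intro!: derivative_eq_intros)
    moreover have "2 * (\<rho> + t * d) * d + 2 * (t * c) * c = 2 * (\<rho> * d + t * (c\<^sup>2 + d\<^sup>2))"
      by (simp add: algebra_simps power2_eq_square)
    ultimately show ?thesis
      by (simp add: cd)
  qed
  define \<theta> where "\<theta> t = arctan (t * c / (\<rho> + t * d))" for t
  have d\<theta>: "(\<theta> has_real_derivative c * \<rho> / N t) (at t)" if "\<bar>t\<bar> < \<rho>" for t
  proof -
    let ?p = "\<rho> + t * d"
    have "(\<theta> has_real_derivative (c * ?p - t * c * d) / (?p * ?p) * inverse (1 + (t * c / ?p)\<^sup>2)) (at t)"
      unfolding \<theta>_def using pos[OF that] by (auto intro!: derivative_eq_intros)
    moreover have "(c * ?p - t * c * d) / (?p * ?p) * inverse (1 + (t * c / ?p)\<^sup>2) = c * \<rho> / N t"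
    proof -
      have "1 + (s / p)\<^sup>2 = (p\<^sup>2 + s\<^sup>2) / (p * p)" if "p > 0" for p s :: real
        using that by (simp add: field_simps power2_eq_square)
      from this[OF pos[OF that]] have "1 + (t * c / ?p)\<^sup>2 = N t / (?p * ?p)"
        unfolding N_def .
      moreover have "c * ?p - t * c * d = c * \<rho>"
        by (simp add: algebra_simps)
      ultimately show ?thesis
        using pos[OF that] N[OF that] by simp
    qed
    ultimately show ?thesis
      by simp
  qed
  define f' where "f' t = (\<rho> * d + t) / N t * I + \<Psi> (\<theta> t) * (c * \<rho> / N t)" for t
  have df: "(f has_real_derivative f' t) (at t)" if t: "\<bar>t\<bar> < \<rho>" for t
  proof -
    have ev: "eventually (\<lambda>s. f s = ln (N s) / 2 * I + \<Phi> (\<theta> s)) (nhds t)"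
    proof -
      have "eventually (\<lambda>s. \<bar>s\<bar> < \<rho>) (nhds t)"
        using t by (intro eventually_nhds_in_open[of "{s. \<bar>s\<bar> < \<rho>}", simplified] open_Collect_less continuous_intros)
      then show ?thesis
      proof eventually_elim
        case (elim s)
        then show ?case
          using N[OF elim] by (simp add: f \<theta>_def N_def ln_sqrt)
      qed
    qed
    have "((\<lambda>s. ln (N s) / 2 * I + \<Phi> (\<theta> s)) has_real_derivative f' t) (at t)"
      unfolding f'_def using N[OF t]
      by (auto intro!: derivative_eq_intros dN d\<theta>[OF t] DERIV_chain2[OF \<Phi>] simp: field_simps)
    then show ?thesis
      using DERIV_cong_ev[OF refl ev refl] by blast
  qed
  \<comment> \<open>At 0 the angle has first derivative \<open>c / \<rho>\<close> and second
    derivative \<open>- 2 * c * d / \<rho>^2\<close>, and the logarithm of the radius has second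
    derivative \<open>(1 - 2 * d^2) / \<rho>^2\<close>; these are the three coefficients.\<close>
  have "(f' has_real_derivative
      ((1 - 2 * d\<^sup>2) * I + c\<^sup>2 * X 0 - 2 * c * d * \<Psi> 0) / \<rho>\<^sup>2) (at 0)"
  proof -
    have N0: "N 0 = \<rho>\<^sup>2" "\<theta> 0 = 0"
      by (simp_all add: N_def \<theta>_def)
    have dN0: "(N has_real_derivative 2 * (\<rho> * d)) (at 0)"
      using dN[of 0] by simp
    have d\<theta>0: "(\<theta> has_real_derivative c / \<rho>) (at 0)"
      using d\<theta>[of 0] \<rho> by (simp add: N0 power2_eq_square)
    have 1: "((\<lambda>t. (\<rho> * d + t) / N t) has_real_derivative
        (1 * N 0 - (\<rho> * d + 0) * (2 * (\<rho> * d))) / (N 0 * N 0)) (at 0)"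
      using \<rho> by (intro DERIV_divide dN0) (auto intro!: derivative_eq_intros simp: N0)
    have 2: "((\<lambda>t. c * \<rho> / N t) has_real_derivative
        (0 * N 0 - c * \<rho> * (2 * (\<rho> * d))) / (N 0 * N 0)) (at 0)"
      using \<rho> by (intro DERIV_divide dN0) (auto intro!: derivative_eq_intros simp: N0)
    have 3: "((\<lambda>t. \<Psi> (\<theta> t)) has_real_derivative X (\<theta> 0) * (c / \<rho>)) (at 0)"
      by (rule DERIV_chain2[OF \<Psi> d\<theta>0])
    have 4: "(f' has_real_derivative (1 * N 0 - (\<rho> * d + 0) * (2 * (\<rho> * d))) / (N 0 * N 0) * I
        + (X (\<theta> 0) * (c / \<rho>) * (c * \<rho> / N 0)
          + (0 * N 0 - c * \<rho> * (2 * (\<rho> * d))) / (N 0 * N 0) * \<Psi> (\<theta> 0))) (at 0)"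
      unfolding f'_def by (rule DERIV_add[OF DERIV_cmult_right[OF 1] DERIV_mult[OF 3 2]])
    have 5: "(1 * N 0 - (\<rho> * d + 0) * (2 * (\<rho> * d))) / (N 0 * N 0) * I
        + (X (\<theta> 0) * (c / \<rho>) * (c * \<rho> / N 0)
          + (0 * N 0 - c * \<rho> * (2 * (\<rho> * d))) / (N 0 * N 0) * \<Psi> (\<theta> 0))
        = ((1 - 2 * d\<^sup>2) * I + c\<^sup>2 * X 0 - 2 * c * d * \<Psi> 0) / \<rho>\<^sup>2"
      using \<rho> unfolding N0 by (simp add: field_simps power2_eq_square)
    show ?thesis
      using 4 unfolding 5 .
  qed
  with \<rho> df show ?thesis
    by (rule deriv_deriv_eqI)
qed

context invariant_sphere_measure
begin

text \<open>Writing \<open>e = d a + c b\<close>, the integrand \<open>B\<close> is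
  \<open>c^2 * k - 2 * c * d * h\<close>, with \<open>h\<close> and \<open>k\<close> the first and
  second derivatives of \<open>g\<close> along the rotation. Expressing it through \<open>a\<close>
  and \<open>e\<close> alone removes \<open>b\<close>, which varies with \<open>e\<close>, and so
  permits summation over coordinate directions.\<close>

lemma deriv_deriv_log_potential:
  fixes g :: "real ^ 'n \<Rightarrow> real" and G :: "real ^ 'n \<Rightarrow> real ^ 'n"
  assumes n: "2 \<le> CARD('n)" and z: "z \<noteq> 0" and e: "norm e = 1" and a_def: "a = z /\<^sub>R norm z"
    and dg: "\<And>\<xi>. \<xi> \<noteq> 0 \<Longrightarrow> (g has_derivative (\<lambda>v. G \<xi> \<bullet> v)) (at \<xi>)"
    and dG: "\<And>\<xi>. \<xi> \<noteq> 0 \<Longrightarrow> (G has_derivative H \<xi>) (at \<xi>)"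
    and cont_H: "\<And>v. continuous_on (sphere 0 1) (\<lambda>\<xi>. H \<xi> v)"
  defines "B \<equiv> (\<lambda>\<xi>. H \<xi> ((\<xi> \<bullet> a) *\<^sub>R e - (\<xi> \<bullet> e) *\<^sub>R a) \<bullet> ((\<xi> \<bullet> a) *\<^sub>R e - (\<xi> \<bullet> e) *\<^sub>R a)
      - G \<xi> \<bullet> ((\<xi> \<bullet> a - 3 * (e \<bullet> a) * (\<xi> \<bullet> e)) *\<^sub>R a + (\<xi> \<bullet> e + (e \<bullet> a) * (\<xi> \<bullet> a)) *\<^sub>R e))"
  shows "integrable \<sigma> (\<lambda>\<xi>. ln \<bar>\<xi> \<bullet> a\<bar> * B \<xi>)"
    and "deriv (deriv (\<lambda>t. log_potential g (z + t *\<^sub>R e))) 0 =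
      ((1 - 2 * (e \<bullet> a)\<^sup>2) * (LINT \<xi>|\<sigma>. g \<xi>) + (LINT \<xi>|\<sigma>. ln \<bar>\<xi> \<bullet> a\<bar> * B \<xi>)) / (norm z)\<^sup>2"
proof -
  define \<rho> where "\<rho> = norm z"
  have \<rho>: "\<rho> > 0" "z = \<rho> *\<^sub>R a"
    using z by (simp_all add: \<rho>_def a_def)
  have a: "norm a = 1"
    using z by (simp add: a_def)
  define d where "d = e \<bullet> a"
  define p where "p = e - d *\<^sub>R a"
  have aa: "a \<bullet> a = 1"
    using a by (simp add: dot_square_norm)
  have pa: "a \<bullet> p = 0"
    by (simp add: p_def d_def inner_diff_right aa inner_commute)
  \<comment> \<open>If \<open>e\<close> is parallel to \<open>a\<close>, then \<open>c = 0\<close>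
    and any unit vector orthogonal to \<open>a\<close> will do; one exists because the dimension is
    at least 2.\<close>
  obtain b c where b: "norm b = 1" and ab: "a \<bullet> b = 0" and p: "p = c *\<^sub>R b"
  proof (cases "p = 0")
    case True
    obtain y :: "real^'n" where "y \<noteq> 0" "orthogonal a y"
      using orthogonal_to_vector_exists[of a] n by auto
    then show thesis
      using that[of "y /\<^sub>R norm y" 0] True by (simp add: orthogonal_def)
  next
    case False
    then show thesis
      using that[of "p /\<^sub>R norm p" "norm p"] pa by simp
  qed
  have e_eq: "e = d *\<^sub>R a + c *\<^sub>R b"
    using p by (simp add: p_def algebra_simps)
  have bb: "b \<bullet> b = 1" "b \<bullet> a = 0"
    using b ab by (simp_all add: dot_square_norm inner_commute)
  have cd: "c\<^sup>2 + d\<^sup>2 = 1"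
  proof -
    have "e \<bullet> e = d * d + c * c"
      unfolding e_eq by (simp add: inner_add_left inner_add_right aa bb ab)
    then show ?thesis
      using e by (simp add: dot_square_norm power2_eq_square)
  qed
  let ?J = "rotation_field a b"
  let ?R = "plane_rotation a b"
  define h where "h \<xi> = G \<xi> \<bullet> ?J \<xi>" for \<xi>
  define k where "k \<xi> = H \<xi> (?J \<xi>) \<bullet> ?J \<xi> + G \<xi> \<bullet> ?J (?J \<xi>)" for \<xi>
  have linH: "linear (H \<xi>)" if "\<xi> \<noteq> 0" for \<xi>
    using dG[OF that] by (rule has_derivative_linear)
  have linJ: "bounded_linear ?J"
    unfolding rotation_field_def by (intro bounded_linear_intros)
  have cont_J: "continuous_on S ?J" for S
    by (rule linear_continuous_on[OF linJ])
  have nz: "\<xi> \<noteq> 0" if "\<xi> \<in> sphere 0 1" for \<xi> :: "real^'n"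
    using that by auto
  have cont_g: "continuous_on (sphere 0 1) g"
    using dg nz by (meson continuous_at_imp_continuous_on has_derivative_continuous)
  have cont_G: "continuous_on (sphere 0 1) G"
    using dG nz by (meson continuous_at_imp_continuous_on has_derivative_continuous)
  have cont_h: "continuous_on (sphere 0 1) h"
    unfolding h_def by (intro continuous_intros cont_G cont_J)
  have cont_k: "continuous_on (sphere 0 1) k"
  proof -
    \<comment> \<open>Continuity of \<open>H \<xi> v\<close> is available only for fixed
      \<open>v\<close>, so \<open>H \<xi> (?J \<xi>)\<close> is first expanded by linearity into
      \<open>H \<xi> a\<close> and \<open>H \<xi> b\<close>.\<close>
    have "continuous_on (sphere 0 1) (\<lambda>\<xi>. ((\<xi> \<bullet> a) *\<^sub>R H \<xi> b - (\<xi> \<bullet> b) *\<^sub>R H \<xi> a) \<bullet> ?J \<xi> + G \<xi> \<bullet> ?J (?J \<xi>))"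
      by (intro continuous_intros cont_G cont_J cont_H continuous_on_compose2[OF cont_J]) auto
    then show ?thesis
    proof (rule continuous_on_eq)
      show "((\<xi> \<bullet> a) *\<^sub>R H \<xi> b - (\<xi> \<bullet> b) *\<^sub>R H \<xi> a) \<bullet> ?J \<xi> + G \<xi> \<bullet> ?J (?J \<xi>) = k \<xi>"
        if "\<xi> \<in> sphere 0 1" for \<xi>
        using linH[OF nz[OF that]]
        by (simp add: k_def rotation_field_def[of a b \<xi>] linear_diff linear_cmul)
    qed
  qed
  have ortho: "orthogonal_transformation (?R t)" for t
    by (rule orthogonal_transformation_plane_rotation[OF a b ab])
  have R_nz: "?R t \<xi> \<noteq> 0" if "norm \<xi> = 1" for t \<xi>
    using orthogonal_transformation_norm[OF ortho[of t], of \<xi>] that by auto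
  have R': "((\<lambda>\<theta>. ?R \<theta> \<xi>) has_derivative (\<lambda>t. t *\<^sub>R ?J (?R \<theta> \<xi>))) (at \<theta>)" for \<theta> \<xi>
    using plane_rotation_has_vector_derivative[OF a b ab] by (simp add: has_vector_derivative_def)
  have dgh: "((\<lambda>\<theta>. g (?R \<theta> \<xi>)) has_real_derivative h (?R \<theta> \<xi>)) (at \<theta>)" if "norm \<xi> = 1" for \<xi> \<theta>
    using has_derivative_compose[OF R' dg[OF R_nz[OF that]]]
    by (simp add: has_field_derivative_def h_def mult.commute[of _ "_ \<bullet> _"])
  have dhk: "((\<lambda>\<theta>. h (?R \<theta> \<xi>)) has_real_derivative k (?R \<theta> \<xi>)) (at \<theta>)" if \<xi>: "norm \<xi> = 1" for \<xi> \<theta>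
  proof -
    let ?x = "?R \<theta> \<xi>"
    have 1: "((\<lambda>\<theta>. G (?R \<theta> \<xi>)) has_derivative (\<lambda>t. H ?x (t *\<^sub>R ?J ?x))) (at \<theta>)"
      by (rule has_derivative_compose[OF R' dG[OF R_nz[OF \<xi>]]])
    have 2: "((\<lambda>\<theta>. ?J (?R \<theta> \<xi>)) has_derivative (\<lambda>t. ?J (t *\<^sub>R ?J ?x))) (at \<theta>)"
      by (rule has_derivative_compose[OF R' bounded_linear_imp_has_derivative[OF linJ]])
    have "((\<lambda>\<theta>. h (?R \<theta> \<xi>)) has_derivative
        (\<lambda>t. G ?x \<bullet> ?J (t *\<^sub>R ?J ?x) + H ?x (t *\<^sub>R ?J ?x) \<bullet> ?J ?x)) (at \<theta>)"
      unfolding h_def by (rule has_derivative_inner[OF 1 2])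
    moreover have "G ?x \<bullet> ?J (t *\<^sub>R ?J ?x) + H ?x (t *\<^sub>R ?J ?x) \<bullet> ?J ?x = k ?x * t" for t
      by (simp add: k_def linear_cmul[OF linH[OF R_nz[OF \<xi>]]]
          linear_cmul[OF bounded_linear.linear[OF linJ]] algebra_simps)
    ultimately show ?thesis
      by (simp add: has_field_derivative_def)
  qed
  have B_eq: "B \<xi> = c\<^sup>2 * k \<xi> - 2 * c * d * h \<xi>" if "\<xi> \<noteq> 0" for \<xi>
  proof -
    let ?v = "(\<xi> \<bullet> a) *\<^sub>R e - (\<xi> \<bullet> e) *\<^sub>R a"
    have "?v = c *\<^sub>R ?J \<xi>"
      unfolding e_eq rotation_field_def by (simp add: inner_add_right algebra_simps)
    then have 1: "H \<xi> ?v \<bullet> ?v = c\<^sup>2 * (H \<xi> (?J \<xi>) \<bullet> ?J \<xi>)"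
      by (simp add: linear_cmul[OF linH[OF that]] power2_eq_square)
    \<comment> \<open>The relation \<open>c * c = 1 - d * d\<close> in the right-nested shape that
      the products take after full expansion.\<close>
    have c2: "c * (c * x) = x - d * (d * x)" for x
    proof -
      have "c * c = 1 - d * d"
        using cd by (simp add: power2_eq_square)
      then show ?thesis
        unfolding mult.assoc[symmetric] by (simp add: left_diff_distrib)
    qed
    have 2: "G \<xi> \<bullet> ((\<xi> \<bullet> a - 3 * d * (\<xi> \<bullet> e)) *\<^sub>R a + (\<xi> \<bullet> e + d * (\<xi> \<bullet> a)) *\<^sub>R e) =
        2 * c * d * (G \<xi> \<bullet> ?J \<xi>) - c\<^sup>2 * (G \<xi> \<bullet> ?J (?J \<xi>))"
      unfolding rotation_field_iterate[OF a b ab] unfolding rotation_field_def e_eq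
      by (simp add: inner_add_right inner_diff_right power2_eq_square algebra_simps)
        (simp add: c2 algebra_simps)
    show ?thesis
      unfolding B_def d_def[symmetric] 1 2 by (simp add: h_def k_def algebra_simps)
  qed
  have int_h: "integrable \<sigma> (\<lambda>\<xi>. ln \<bar>\<xi> \<bullet> a\<bar> * h \<xi>)" and int_k: "integrable \<sigma> (\<lambda>\<xi>. ln \<bar>\<xi> \<bullet> a\<bar> * k \<xi>)"
    by (intro integrable_ln_inner_mult a cont_h cont_k)+
  have lnB: "ln \<bar>\<xi> \<bullet> a\<bar> * B \<xi> = c\<^sup>2 * (ln \<bar>\<xi> \<bullet> a\<bar> * k \<xi>) - 2 * c * d * (ln \<bar>\<xi> \<bullet> a\<bar> * h \<xi>)"
    if "\<xi> \<in> space \<sigma>" for \<xi>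
  proof -
    have "\<xi> \<noteq> 0"
      using that by (intro nz) (simp add: space_eq)
    from B_eq[OF this] show ?thesis
      by (simp add: right_diff_distrib mult_ac)
  qed
  show "integrable \<sigma> (\<lambda>\<xi>. ln \<bar>\<xi> \<bullet> a\<bar> * B \<xi>)"
    using int_h int_k by (subst Bochner_Integration.integrable_cong[OF refl lnB]) auto
  have B_int: "(LINT \<xi>|\<sigma>. ln \<bar>\<xi> \<bullet> a\<bar> * B \<xi>) =
      c\<^sup>2 * (LINT \<xi>|\<sigma>. ln \<bar>\<xi> \<bullet> a\<bar> * k \<xi>) - 2 * c * d * (LINT \<xi>|\<sigma>. ln \<bar>\<xi> \<bullet> a\<bar> * h \<xi>)"
    using int_h int_k by (subst Bochner_Integration.integral_cong[OF refl lnB]) auto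
  have "deriv (deriv (\<lambda>t. log_potential g (z + t *\<^sub>R e))) 0 =
      ((1 - 2 * d\<^sup>2) * (LINT \<xi>|\<sigma>. g \<xi>)
        + c\<^sup>2 * (LINT \<xi>|\<sigma>. ln \<bar>\<xi> \<bullet> a\<bar> * k (?R 0 \<xi>))
        - 2 * c * d * (LINT \<xi>|\<sigma>. ln \<bar>\<xi> \<bullet> a\<bar> * h (?R 0 \<xi>))) / \<rho>\<^sup>2"
  proof (rule deriv_deriv_polar_line[OF \<rho>(1) cd
        has_real_derivative_integral_ln_rotation[OF a b ab cont_g cont_h dgh]
        has_real_derivative_integral_ln_rotation[OF a b ab cont_h cont_k dhk]])
    fix t assume t: "\<bar>t\<bar> < \<rho>"
    define q where "q = \<rho> + t * d"
    have "\<bar>d\<bar> \<le> 1"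
      using Cauchy_Schwarz_ineq2[of e a] a e by (simp add: d_def)
    then have "\<bar>t * d\<bar> \<le> \<bar>t\<bar> * 1"
      unfolding abs_mult by (intro mult_left_mono) auto
    \<comment> \<open>Positivity keeps the point in the half plane where \<open>arctan\<close> gives
      the true polar angle, with no change of branch.\<close>
    then have q: "q > 0"
      using t by (simp add: q_def)
    define r where "r = sqrt (q\<^sup>2 + (t * c)\<^sup>2)"
    have r: "r = q * sqrt (1 + (t * c / q)\<^sup>2)"
    proof -
      have "q\<^sup>2 + (t * c)\<^sup>2 = q\<^sup>2 * (1 + (t * c / q)\<^sup>2)"
        using q by (simp add: field_simps)
      then show ?thesis
        using q by (simp add: r_def real_sqrt_mult)
    qed
    have root: "sqrt (1 + (t * c / q)\<^sup>2) > 0"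
      by (simp add: add_pos_nonneg)
    have "z + t *\<^sub>R e = q *\<^sub>R a + (t * c) *\<^sub>R b"
      by (simp add: \<rho>(2) e_eq q_def algebra_simps)
    also have "\<dots> = r *\<^sub>R (cos (arctan (t * c / q)) *\<^sub>R a + sin (arctan (t * c / q)) *\<^sub>R b)"
      using q root by (simp add: cos_arctan sin_arctan r algebra_simps)
    finally have polar: "z + t *\<^sub>R e =
        r *\<^sub>R (cos (arctan (t * c / q)) *\<^sub>R a + sin (arctan (t * c / q)) *\<^sub>R b)" .
    have "r > 0"
      using q root by (simp add: r)
    from log_potential_polar[OF a b ab cont_g this polar]
    show "log_potential g (z + t *\<^sub>R e) =
        ln (sqrt ((\<rho> + t * d)\<^sup>2 + (t * c)\<^sup>2)) * (LINT \<xi>|\<sigma>. g \<xi>) +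
        (LINT \<xi>|\<sigma>. ln \<bar>\<xi> \<bullet> a\<bar> * g (?R (arctan (t * c / (\<rho> + t * d))) \<xi>))"
      unfolding r_def q_def .
  qed
  then show "deriv (deriv (\<lambda>t. log_potential g (z + t *\<^sub>R e))) 0 =
      ((1 - 2 * (e \<bullet> a)\<^sup>2) * (LINT \<xi>|\<sigma>. g \<xi>) + (LINT \<xi>|\<sigma>. ln \<bar>\<xi> \<bullet> a\<bar> * B \<xi>)) / (norm z)\<^sup>2"
    by (simp add: B_int d_def \<rho>_def add_diff_eq)
qed

end

section \<open>Homogeneous functions and partial derivatives\<close>

text \<open>Differentiate the homogeneity identity in \<open>s\<close> at 1 for Euler's relation,
  and in \<open>x\<close> for the homogeneity of the derivative. General codomains cover both
  \<open>g\<close> and its gradient; negative \<open>s\<close> are included so that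
  \<open>s = -1\<close> yields parity.\<close>

lemma has_derivative_homogeneous:
  fixes f :: "'a::real_normed_vector \<Rightarrow> 'b::real_normed_vector"
  assumes hom: "\<And>s x. s \<noteq> 0 \<Longrightarrow> x \<noteq> 0 \<Longrightarrow> f (s *\<^sub>R x) = inverse (s ^ p) *\<^sub>R f x"
    and D: "\<And>x. x \<noteq> 0 \<Longrightarrow> (f has_derivative D x) (at x)"
    and x: "x \<noteq> 0"
  shows "D x x = - real p *\<^sub>R f x"
    and "s \<noteq> 0 \<Longrightarrow> D (s *\<^sub>R x) v = inverse (s ^ Suc p) *\<^sub>R D x v"
proof -
  have "((\<lambda>s. f (s *\<^sub>R x)) has_derivative (\<lambda>h. D (1 *\<^sub>R x) (h *\<^sub>R x))) (at 1)"
    using D[of "1 *\<^sub>R x"] x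
    by (intro has_derivative_compose[of "\<lambda>s. s *\<^sub>R x" _ _ _ f]) (auto intro!: derivative_eq_intros)
  then have 1: "((\<lambda>s. f (s *\<^sub>R x)) has_derivative (\<lambda>h. D x (h *\<^sub>R x))) (at 1)"
    by simp
  have "((\<lambda>s. inverse (s ^ p)) has_real_derivative - real p) (at 1)"
    by (auto intro!: derivative_eq_intros)
  then have "((\<lambda>s. inverse (s ^ p) *\<^sub>R f x) has_derivative (\<lambda>h. (- real p * h) *\<^sub>R f x)) (at 1)"
    unfolding has_field_derivative_def by (rule has_derivative_scaleR_left)
  then have "((\<lambda>s. f (s *\<^sub>R x)) has_derivative (\<lambda>h. (- real p * h) *\<^sub>R f x)) (at 1)"
    by (rule has_derivative_transform_within_open[of _ _ _ _ "- {0}"]) (auto simp: hom x)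
  from has_derivative_unique[OF 1 this] show "D x x = - real p *\<^sub>R f x"
    by (metis mult.right_neutral scaleR_one)
  assume s: "s \<noteq> 0"
  have 2: "((\<lambda>x. f (s *\<^sub>R x)) has_derivative (\<lambda>v. D (s *\<^sub>R x) (s *\<^sub>R v))) (at x)"
    using D[of "s *\<^sub>R x"] x s
    by (intro has_derivative_compose[of "\<lambda>x. s *\<^sub>R x" _ _ _ f]) (auto intro!: derivative_eq_intros)
  have "((\<lambda>x. inverse (s ^ p) *\<^sub>R f x) has_derivative (\<lambda>v. inverse (s ^ p) *\<^sub>R D x v)) (at x)"
    by (rule has_derivative_scaleR_right[OF D[OF x]])
  then have "((\<lambda>x. f (s *\<^sub>R x)) has_derivative (\<lambda>v. inverse (s ^ p) *\<^sub>R D x v)) (at x)"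
    by (rule has_derivative_transform_within_open[of _ _ _ _ "- {0}"]) (auto simp: hom x s)
  from has_derivative_unique[OF 2 this]
  have "s *\<^sub>R D (s *\<^sub>R x) v = inverse (s ^ p) *\<^sub>R D x v"
    using linear_cmul[OF has_derivative_linear[OF D[of "s *\<^sub>R x"]]] x s by (auto dest: fun_cong)
  then have "inverse s *\<^sub>R (s *\<^sub>R D (s *\<^sub>R x) v) = inverse s *\<^sub>R (inverse (s ^ p) *\<^sub>R D x v)"
    by simp
  then show "D (s *\<^sub>R x) v = inverse (s ^ Suc p) *\<^sub>R D x v"
    using s by simp
qed

lemma has_derivative_imp_partial:
  assumes "(f has_derivative D) (at x)"
  shows "partial i f x = D (axis i 1)"
proof -
  have "((\<lambda>t. f (x + t *\<^sub>R axis i 1)) has_derivative (\<lambda>t. D (t *\<^sub>R axis i 1))) (at 0)"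
    using assms by (intro has_derivative_compose[of "\<lambda>t. x + t *\<^sub>R axis i 1" _ _ _ f])
      (auto intro!: derivative_eq_intros)
  moreover have "D (t *\<^sub>R axis i 1) = D (axis i 1) * t" for t
    using linear_cmul[OF has_derivative_linear[OF assms]] by simp
  ultimately have "((\<lambda>t. f (x + t *\<^sub>R axis i 1)) has_real_derivative D (axis i 1)) (at 0)"
    by (simp add: has_field_derivative_def)
  then show ?thesis
    unfolding partial_def by (rule DERIV_imp_deriv)
qed

lemma partial_partial_eq_deriv_deriv:
  "partial i (partial i f) x = deriv (deriv (\<lambda>t. f (x + t *\<^sub>R axis i 1))) 0"
proof -
  have "partial i f (x + t *\<^sub>R axis i 1) = deriv (\<lambda>t. f (x + t *\<^sub>R axis i 1)) t" for t
    unfolding partial_def deriv_shift_0[of _ t] by (simp add: o_def scaleR_add_left add.assoc)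
  then show ?thesis
    by (subst partial_def) simp
qed

lemma partial_forms_of_has_derivative:
  fixes f :: "real ^ 'n::finite \<Rightarrow> real" and G :: "real ^ 'n \<Rightarrow> real ^ 'n"
  assumes dg: "\<And>\<xi>. \<xi> \<noteq> 0 \<Longrightarrow> (f has_derivative (\<lambda>v. G \<xi> \<bullet> v)) (at \<xi>)"
    and dG: "\<And>\<xi>. \<xi> \<noteq> 0 \<Longrightarrow> (G has_derivative H \<xi>) (at \<xi>)"
    and \<xi>: "\<xi> \<noteq> 0"
  shows "grad_form f \<xi> v = G \<xi> \<bullet> v"
    and "hess_form f \<xi> v = H \<xi> v \<bullet> v"
    and "laplacian f \<xi> = (\<Sum>i\<in>UNIV. H \<xi> (axis i 1) \<bullet> axis i 1)"
proof -
  have p1: "partial h f \<zeta> = G \<zeta> $ h" if "\<zeta> \<noteq> 0" for h \<zeta>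
    by (simp add: has_derivative_imp_partial[OF dg[OF that]] inner_axis)
  have p2: "partial k (partial h f) \<xi> = H \<xi> (axis k 1) $ h" for h k
  proof -
    have "((\<lambda>\<zeta>. G \<zeta> $ h) has_derivative (\<lambda>v. H \<xi> v $ h)) (at \<xi>)"
      by (rule bounded_linear.has_derivative[OF bounded_linear_vec_nth dG[OF \<xi>]])
    \<comment> \<open>\<open>partial h f\<close> agrees with the component of \<open>G\<close> only
      away from the origin, so the transfer takes place in the open set
      \<open>- {0}\<close>.\<close>
    then have "(partial h f has_derivative (\<lambda>v. H \<xi> v $ h)) (at \<xi>)"
      by (rule has_derivative_transform_within_open[of _ _ _ _ "- {0}"]) (auto simp: p1 \<xi>)
    then show ?thesis
      by (rule has_derivative_imp_partial)
  qed
  have lin: "linear (H \<xi>)"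
    using dG[OF \<xi>] by (rule has_derivative_linear)
  have H: "H \<xi> v = (\<Sum>k\<in>UNIV. v $ k *\<^sub>R H \<xi> (axis k 1))"
  proof -
    have "H \<xi> (\<Sum>k\<in>UNIV. v $ k *\<^sub>R axis k 1) = (\<Sum>k\<in>UNIV. v $ k *\<^sub>R H \<xi> (axis k 1))"
      by (simp add: linear_sum[OF lin] linear_cmul[OF lin])
    then show ?thesis
      using basis_expansion[of v] by (simp add: scalar_mult_eq_scaleR)
  qed
  show "grad_form f \<xi> v = G \<xi> \<bullet> v"
    by (simp add: grad_form_def p1[OF \<xi>] inner_vec_def)
  have "H \<xi> v \<bullet> v = (\<Sum>k\<in>UNIV. v $ k * (H \<xi> (axis k 1) \<bullet> v))"
    by (subst H) (simp add: inner_sum_left)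
  then show "hess_form f \<xi> v = H \<xi> v \<bullet> v"
    by (simp add: hess_form_def p2 inner_vec_def sum_distrib_left mult_ac)
  show "laplacian f \<xi> = (\<Sum>i\<in>UNIV. H \<xi> (axis i 1) \<bullet> axis i 1)"
    by (simp add: laplacian_def p2 inner_axis)
qed

section \<open>Gradient and Hessian of the reciprocal of a polynomial\<close>

lemma real_polynomial_function_gradient:
  fixes p :: "'a::euclidean_space \<Rightarrow> real"
  assumes "real_polynomial_function p"
  shows "\<exists>G. polynomial_function G \<and> (\<forall>x. (p has_derivative (\<lambda>v. G x \<bullet> v)) (at x))"
  using assms
proof induction
  case (linear f)
  \<comment> \<open>A linear functional is represented by the vector
    \<open>adjoint f 1\<close>.\<close>
  have "f v = adjoint f 1 \<bullet> v" for v
    using adjoint_works[OF bounded_linear.linear[OF linear], of v 1] by (simp add: inner_commute)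
  then have "(f has_derivative (\<lambda>v. adjoint f 1 \<bullet> v)) (at x)" for x
    using bounded_linear_imp_has_derivative[OF linear] by (metis (no_types, lifting) ext)
  then show ?case
    by (intro exI[of _ "\<lambda>_. adjoint f 1"]) auto
next
  case (const c)
  then show ?case
    by (intro exI[of _ "\<lambda>_. 0"]) auto
next
  case (add f g)
  then obtain F G where "polynomial_function F" "\<forall>x. (f has_derivative (\<lambda>v. F x \<bullet> v)) (at x)"
    "polynomial_function G" "\<forall>x. (g has_derivative (\<lambda>v. G x \<bullet> v)) (at x)"
    by blast
  then show ?case
    by (intro exI[of _ "\<lambda>x. F x + G x"]) (auto intro!: derivative_eq_intros simp: inner_add_left)
next
  case (mult f g)
  then obtain F G where FG: "polynomial_function F" "\<And>x. (f has_derivative (\<lambda>v. F x \<bullet> v)) (at x)"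
    "polynomial_function G" "\<And>x. (g has_derivative (\<lambda>v. G x \<bullet> v)) (at x)"
    by blast
  have "((\<lambda>x. f x * g x) has_derivative (\<lambda>v. (f x *\<^sub>R G x + g x *\<^sub>R F x) \<bullet> v)) (at x)" for x
    using has_derivative_mult[OF FG(2)[of x] FG(4)[of x]] by (simp add: inner_add_left mult_ac)
  moreover have "polynomial_function (\<lambda>x. f x *\<^sub>R G x + g x *\<^sub>R F x)"
    using FG mult.hyps by (intro polynomial_function_add polynomial_function_mult)
      (auto simp: real_polynomial_function_eq)
  ultimately show ?case
    by blast
qed

lemma polynomial_function_has_derivative:
  fixes F :: "'a::euclidean_space \<Rightarrow> 'b::euclidean_space"
  assumes "polynomial_function F"
  obtains H where "\<And>v. polynomial_function (\<lambda>x. H x v)" "\<And>x. (F has_derivative H x) (at x)"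
proof -
  have "\<exists>G. polynomial_function G \<and> (\<forall>x. ((\<lambda>x. F x \<bullet> b) has_derivative (\<lambda>v. G x \<bullet> v)) (at x))" for b
    using assms by (intro real_polynomial_function_gradient) (auto simp: polynomial_function_inner real_polynomial_function_eq)
  then obtain G where G: "\<And>b. polynomial_function (G b)"
      "\<And>b x. ((\<lambda>x. F x \<bullet> b) has_derivative (\<lambda>v. G b x \<bullet> v)) (at x)"
    by metis
  show thesis
  proof (rule that[of "\<lambda>x v. \<Sum>b\<in>Basis. (G b x \<bullet> v) *\<^sub>R b"])
    show "polynomial_function (\<lambda>x. \<Sum>b\<in>Basis. (G b x \<bullet> v) *\<^sub>R b)" for v
      by (intro polynomial_function_sum polynomial_function_mult polynomial_function_inner G
          polynomial_function_const) auto
    show "(F has_derivative (\<lambda>v. \<Sum>b\<in>Basis. (G b x \<bullet> v) *\<^sub>R b)) (at x)" for x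
      unfolding has_derivative_componentwise_within[of F]
      using G(2)[of _ x] by (simp add: inner_sum_left_Basis)
  qed
qed

lemma one_over_polynomial_derivatives:
  fixes Q :: "'a::euclidean_space \<Rightarrow> real"
  assumes Q: "real_polynomial_function Q" and nz: "\<And>x. x \<noteq> 0 \<Longrightarrow> Q x \<noteq> 0"
  obtains G H where
    "\<And>x. x \<noteq> 0 \<Longrightarrow> ((\<lambda>x. 1 / Q x) has_derivative (\<lambda>v. G x \<bullet> v)) (at x)"
    "\<And>x. x \<noteq> 0 \<Longrightarrow> (G has_derivative H x) (at x)"
    "\<And>v. continuous_on (- {0}) (\<lambda>x. H x v)"
proof -
  obtain P where P: "polynomial_function P" "\<And>x. (Q has_derivative (\<lambda>v. P x \<bullet> v)) (at x)"
    using real_polynomial_function_gradient[OF Q] by blast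
  obtain R where R: "\<And>v. polynomial_function (\<lambda>x. R x v)" "\<And>x. (P has_derivative R x) (at x)"
    using polynomial_function_has_derivative[OF P(1)] by blast
  define G where "G x = (- (1 / (Q x)\<^sup>2)) *\<^sub>R P x" for x
  define H where "H x v = (- (1 / (Q x)\<^sup>2)) *\<^sub>R R x v + (2 * (P x \<bullet> v) / (Q x) ^ 3) *\<^sub>R P x" for x v
  show thesis
  proof (rule that[of G H])
    show "((\<lambda>x. 1 / Q x) has_derivative (\<lambda>v. G x \<bullet> v)) (at x)" if "x \<noteq> 0" for x
      unfolding G_def using nz[OF that]
      by (auto intro!: derivative_eq_intros P(2) simp: power2_eq_square field_simps)
    show "(G has_derivative H x) (at x)" if "x \<noteq> 0" for x
      unfolding G_def H_def using nz[OF that]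
      by (auto intro!: derivative_eq_intros P(2) R(2) simp: power2_eq_square power3_eq_cube field_simps)
    show "continuous_on (- {0}) (\<lambda>x. H x v)" for v
    proof -
      have "continuous_on (- {0}) Q" "continuous_on (- {0}) P" "continuous_on (- {0}) (\<lambda>x. R x v)"
        using Q P(1) R(1) by (auto intro: continuous_on_polymonial_function simp: real_polynomial_function_eq)
      then show ?thesis
        unfolding H_def using nz by (auto intro!: continuous_intros)
    qed
  qed
qed

lemma real_polynomial_function_symbol_poly: "real_polynomial_function (symbol_poly m A)"
proof -
  have "real_polynomial_function (\<lambda>\<xi>. \<Prod>i\<leftarrow>I. \<xi> $ i)" for I :: "'a list"
    by (induction I) (auto intro: real_polynomial_function.intros(2)
        real_polynomial_function.intros(4)[OF real_polynomial_function.intros(1)[OF bounded_linear_vec_nth]])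
  moreover have "finite {I :: 'a list. length I = 2 * m}"
    using finite_lists_length_eq[of "UNIV :: 'a set" "2 * m"] by simp
  ultimately show ?thesis
    unfolding symbol_poly_def[abs_def]
    by (intro real_polynomial_function_sum real_polynomial_function.intros(2,4))
qed

lemma symbol_poly_scaleR: "symbol_poly m A (s *\<^sub>R \<xi>) = s ^ (2 * m) * symbol_poly m A \<xi>"
proof -
  have "(\<Prod>i\<leftarrow>I. (s *\<^sub>R \<xi>) $ i) = s ^ length I * (\<Prod>i\<leftarrow>I. \<xi> $ i)" for I
    by (induction I) auto
  then show ?thesis
    by (simp add: symbol_poly_def sum_distrib_left mult_ac)
qed

section \<open>The Laplacian of the logarithmic potential\<close>

context invariant_sphere_measure
begin

text \<open>The bracket of the theorem, in terms of the gradient \<open>G\<close> and the Hessian \<open>H\<close> of \<open>g\<close>,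
  before Euler's relation is used to eliminate the radial derivatives.\<close>

lemma laplacian_log_potential:
  fixes g :: "real ^ 'n \<Rightarrow> real" and G :: "real ^ 'n \<Rightarrow> real ^ 'n"
  assumes n: "2 \<le> CARD('n)" and xy: "x \<noteq> y" and a_def: "a = (x - y) /\<^sub>R norm (x - y)"
    and dg: "\<And>\<xi>. \<xi> \<noteq> 0 \<Longrightarrow> (g has_derivative (\<lambda>v. G \<xi> \<bullet> v)) (at \<xi>)"
    and dG: "\<And>\<xi>. \<xi> \<noteq> 0 \<Longrightarrow> (G has_derivative H \<xi>) (at \<xi>)"
    and cont_H: "\<And>v. continuous_on (sphere 0 1) (\<lambda>\<xi>. H \<xi> v)"
  defines "S \<equiv> (\<lambda>\<xi>. (\<xi> \<bullet> a)\<^sup>2 * (\<Sum>i\<in>UNIV. H \<xi> (axis i 1) \<bullet> axis i 1) + H \<xi> a \<bullet> a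
      - (\<xi> \<bullet> a) * (H \<xi> \<xi> \<bullet> a + H \<xi> a \<bullet> \<xi>)
      - G \<xi> \<bullet> (((real CARD('n) - 2) * (\<xi> \<bullet> a)) *\<^sub>R a + \<xi>))"
  shows "integrable \<sigma> (\<lambda>\<xi>. ln \<bar>\<xi> \<bullet> a\<bar> * S \<xi>)"
    and "laplacian (\<lambda>y. log_potential g (x - y)) y =
      ((real CARD('n) - 2) * (LINT \<xi>|\<sigma>. g \<xi>) + (LINT \<xi>|\<sigma>. ln \<bar>\<xi> \<bullet> a\<bar> * S \<xi>)) / (norm (x - y))\<^sup>2"
proof -
  \<comment> \<open>The sign comes from \<open>x - y\<close>: moving \<open>y\<close> along a
    coordinate axis moves the argument of the potential in the opposite direction.\<close>
  define e :: "'n \<Rightarrow> real ^ 'n" where "e i = - axis i 1" for i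
  define B where "B i \<xi> = H \<xi> ((\<xi> \<bullet> a) *\<^sub>R e i - (\<xi> \<bullet> e i) *\<^sub>R a) \<bullet> ((\<xi> \<bullet> a) *\<^sub>R e i - (\<xi> \<bullet> e i) *\<^sub>R a)
      - G \<xi> \<bullet> ((\<xi> \<bullet> a - 3 * (e i \<bullet> a) * (\<xi> \<bullet> e i)) *\<^sub>R a + (\<xi> \<bullet> e i + (e i \<bullet> a) * (\<xi> \<bullet> a)) *\<^sub>R e i)" for i \<xi>
  have z: "x - y \<noteq> 0" and norm_e: "norm (e i) = 1" for i
    using xy by (simp_all add: e_def)
  have line: "integrable \<sigma> (\<lambda>\<xi>. ln \<bar>\<xi> \<bullet> a\<bar> * B i \<xi>)"
    "deriv (deriv (\<lambda>t. log_potential g (x - y + t *\<^sub>R e i))) 0 =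
      ((1 - 2 * (e i \<bullet> a)\<^sup>2) * (LINT \<xi>|\<sigma>. g \<xi>) + (LINT \<xi>|\<sigma>. ln \<bar>\<xi> \<bullet> a\<bar> * B i \<xi>)) / (norm (x - y))\<^sup>2" for i
    unfolding B_def by (rule deriv_deriv_log_potential[OF n z norm_e a_def dg dG cont_H]; assumption)+
  have a: "a \<bullet> a = 1"
    using z by (simp add: a_def dot_square_norm power2_eq_square)
  have inner_e: "w \<bullet> e i = - w $ i" for w i
    by (simp add: e_def inner_axis)
  have expand: "(\<Sum>i\<in>UNIV. (w \<bullet> e i) *\<^sub>R e i) = w" for w
    using basis_expansion[of w] by (simp add: e_def inner_axis scalar_mult_eq_scaleR)
  have parseval: "(\<Sum>i\<in>UNIV. (v \<bullet> e i) * (w \<bullet> e i)) = v \<bullet> w" for v w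
    unfolding inner_e by (simp add: inner_vec_def)
  have sum_B: "(\<Sum>i\<in>UNIV. B i \<xi>) = S \<xi>" if \<xi>: "norm \<xi> = 1" for \<xi>
  proof -
    have "\<xi> \<noteq> 0"
      using \<xi> by auto
    from dG[OF this] have lin: "linear (H \<xi>)"
      by (rule has_derivative_linear)
    \<comment> \<open>The only use of \<open>norm \<xi> = 1\<close> in the second-order sum: the
      coefficient of \<open>H \<xi> a \<bullet> a\<close> is the squared norm of
      \<open>\<xi>\<close>.\<close>
    have sq: "(\<Sum>i\<in>UNIV. (\<xi> \<bullet> e i) * ((\<xi> \<bullet> e i) * c)) = c" for c
      using \<xi> by (simp add: mult.assoc[symmetric] sum_distrib_right[symmetric] parseval dot_square_norm)
    have "H \<xi> (e i) \<bullet> e i = H \<xi> (axis i 1) \<bullet> axis i 1" for i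
      by (simp add: e_def linear_neg[OF lin])
    moreover have "H \<xi> \<xi> = (\<Sum>i\<in>UNIV. (\<xi> \<bullet> e i) *\<^sub>R H \<xi> (e i))"
      using arg_cong[OF expand[of \<xi>], of "H \<xi>"] by (simp add: linear_sum[OF lin] linear_cmul[OF lin])
    moreover have "H \<xi> a \<bullet> \<xi> = (\<Sum>i\<in>UNIV. (\<xi> \<bullet> e i) * (H \<xi> a \<bullet> e i))"
      by (simp only: parseval) (rule inner_commute)
    ultimately have second: "(\<Sum>i\<in>UNIV. H \<xi> ((\<xi> \<bullet> a) *\<^sub>R e i - (\<xi> \<bullet> e i) *\<^sub>R a)
          \<bullet> ((\<xi> \<bullet> a) *\<^sub>R e i - (\<xi> \<bullet> e i) *\<^sub>R a)) =
        (\<xi> \<bullet> a)\<^sup>2 * (\<Sum>i\<in>UNIV. H \<xi> (axis i 1) \<bullet> axis i 1) + H \<xi> a \<bullet> a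
          - (\<xi> \<bullet> a) * (H \<xi> \<xi> \<bullet> a + H \<xi> a \<bullet> \<xi>)"
      by (simp add: linear_diff[OF lin] linear_cmul[OF lin] inner_diff_left inner_diff_right
          inner_sum_left sum.distrib sum_subtractf sum_distrib_left[symmetric]
          sum_distrib_right[symmetric] power2_eq_square algebra_simps sq)
    have "(\<Sum>i\<in>UNIV. (\<xi> \<bullet> a - 3 * (e i \<bullet> a) * (\<xi> \<bullet> e i)) *\<^sub>R a
          + (\<xi> \<bullet> e i + (e i \<bullet> a) * (\<xi> \<bullet> a)) *\<^sub>R e i) =
        (\<Sum>i\<in>UNIV. \<xi> \<bullet> a - 3 * ((a \<bullet> e i) * (\<xi> \<bullet> e i))) *\<^sub>R a
          + (\<Sum>i\<in>UNIV. (\<xi> \<bullet> e i) *\<^sub>R e i) + (\<xi> \<bullet> a) *\<^sub>R (\<Sum>i\<in>UNIV. (a \<bullet> e i) *\<^sub>R e i)"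
      by (simp add: scaleR_left.sum scaleR_right.sum sum.distrib sum_subtractf inner_commute[of "e _"] sum_constant_scaleR
          algebra_simps del: sum_constant)
    also have "\<dots> = ((real CARD('n) - 2) * (\<xi> \<bullet> a)) *\<^sub>R a + \<xi>"
    proof -
      have "(\<Sum>i\<in>UNIV. \<xi> \<bullet> a - 3 * ((a \<bullet> e i) * (\<xi> \<bullet> e i))) = real CARD('n) * (\<xi> \<bullet> a) - 3 * (\<xi> \<bullet> a)"
        by (simp add: sum_subtractf sum_distrib_left[symmetric] parseval inner_commute[of a \<xi>])
      then have "(\<Sum>i\<in>UNIV. \<xi> \<bullet> a - 3 * ((a \<bullet> e i) * (\<xi> \<bullet> e i))) *\<^sub>R a
          + (\<Sum>i\<in>UNIV. (\<xi> \<bullet> e i) *\<^sub>R e i) + (\<xi> \<bullet> a) *\<^sub>R (\<Sum>i\<in>UNIV. (a \<bullet> e i) *\<^sub>R e i)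
          = (real CARD('n) * (\<xi> \<bullet> a) - 3 * (\<xi> \<bullet> a) + \<xi> \<bullet> a) *\<^sub>R a + \<xi>"
        by (simp only: expand scaleR_add_left add_ac)
      also have "real CARD('n) * (\<xi> \<bullet> a) - 3 * (\<xi> \<bullet> a) + \<xi> \<bullet> a = (real CARD('n) - 2) * (\<xi> \<bullet> a)"
        by (simp add: algebra_simps)
      finally show ?thesis .
    qed
    finally have first: "(\<Sum>i\<in>UNIV. G \<xi> \<bullet> ((\<xi> \<bullet> a - 3 * (e i \<bullet> a) * (\<xi> \<bullet> e i)) *\<^sub>R a
          + (\<xi> \<bullet> e i + (e i \<bullet> a) * (\<xi> \<bullet> a)) *\<^sub>R e i)) =
        G \<xi> \<bullet> (((real CARD('n) - 2) * (\<xi> \<bullet> a)) *\<^sub>R a + \<xi>)"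
      by (simp only: inner_sum_right[symmetric])
    show ?thesis
      unfolding B_def S_def sum_subtractf first second ..
  qed
  have lnS: "ln \<bar>\<xi> \<bullet> a\<bar> * S \<xi> = (\<Sum>i\<in>UNIV. ln \<bar>\<xi> \<bullet> a\<bar> * B i \<xi>)" if "\<xi> \<in> space \<sigma>" for \<xi>
    using sum_B[of \<xi>] that by (simp add: space_eq sum_distrib_left[symmetric])
  show "integrable \<sigma> (\<lambda>\<xi>. ln \<bar>\<xi> \<bullet> a\<bar> * S \<xi>)"
    using line(1) by (subst Bochner_Integration.integrable_cong[OF refl lnS]) auto
  have S_int: "(LINT \<xi>|\<sigma>. ln \<bar>\<xi> \<bullet> a\<bar> * S \<xi>) = (\<Sum>i\<in>UNIV. LINT \<xi>|\<sigma>. ln \<bar>\<xi> \<bullet> a\<bar> * B i \<xi>)"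
    using line(1) by (subst Bochner_Integration.integral_cong[OF refl lnS]) auto
  have "partial i (partial i (\<lambda>y. log_potential g (x - y))) y =
      ((1 - 2 * (e i \<bullet> a)\<^sup>2) * (LINT \<xi>|\<sigma>. g \<xi>) + (LINT \<xi>|\<sigma>. ln \<bar>\<xi> \<bullet> a\<bar> * B i \<xi>)) / (norm (x - y))\<^sup>2" for i
    unfolding partial_partial_eq_deriv_deriv line(2)[symmetric] by (simp add: e_def diff_diff_eq)
  then have "laplacian (\<lambda>y. log_potential g (x - y)) y =
      (\<Sum>i\<in>UNIV. ((1 - 2 * (e i \<bullet> a)\<^sup>2) * (LINT \<xi>|\<sigma>. g \<xi>) + (LINT \<xi>|\<sigma>. ln \<bar>\<xi> \<bullet> a\<bar> * B i \<xi>)) / (norm (x - y))\<^sup>2)"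
    by (simp add: laplacian_def)
  also have "\<dots> = ((\<Sum>i\<in>UNIV. 1 - 2 * (e i \<bullet> a)\<^sup>2) * (LINT \<xi>|\<sigma>. g \<xi>)
      + (LINT \<xi>|\<sigma>. ln \<bar>\<xi> \<bullet> a\<bar> * S \<xi>)) / (norm (x - y))\<^sup>2"
    by (simp add: S_int sum_divide_distrib[symmetric] sum.distrib sum_distrib_right[symmetric])
  also have "(\<Sum>i\<in>UNIV. 1 - 2 * (e i \<bullet> a)\<^sup>2) = real CARD('n) - 2"
  proof -
    have "(\<Sum>i\<in>UNIV. (e i \<bullet> a)\<^sup>2) = 1"
      using parseval[of a a] by (simp only: a inner_commute[of "e _" a] power2_eq_square)
    then show ?thesis
      by (simp add: sum_subtractf sum_distrib_left[symmetric])
  qed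
  finally show "laplacian (\<lambda>y. log_potential g (x - y)) y =
      ((real CARD('n) - 2) * (LINT \<xi>|\<sigma>. g \<xi>) + (LINT \<xi>|\<sigma>. ln \<bar>\<xi> \<bullet> a\<bar> * S \<xi>)) / (norm (x - y))\<^sup>2" .
qed

text \<open>The antipodal map is orthogonal, so the two open half spheres contribute equally. The
  hypothesis \<open>zero\<close> disposes of the great sphere between them pointwise.\<close>

lemma integral_even_eq_half:
  fixes f :: "real ^ 'n \<Rightarrow> real"
  assumes f: "integrable \<sigma> f" and even: "\<And>\<xi>. norm \<xi> = 1 \<Longrightarrow> f (- \<xi>) = f \<xi>"
    and zero: "\<And>\<xi>. z \<bullet> \<xi> = 0 \<Longrightarrow> f \<xi> = 0"
  shows "(LINT \<xi>|\<sigma>. f \<xi>) = 2 * (LINT \<xi>|\<sigma>. indicator {\<xi>. z \<bullet> \<xi> > 0} \<xi> * f \<xi>)"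
proof -
  let ?i = "\<lambda>\<xi>. indicator {\<xi>. z \<bullet> \<xi> > 0} \<xi> :: real"
  have meas: "?i \<in> borel_measurable \<sigma>"
    by (intro borel_measurable_restrict borel_measurable_indicator borel_open open_Collect_less
        continuous_intros)
  have meas_f: "(\<lambda>\<xi>. ?i \<xi> * f \<xi>) \<in> borel_measurable \<sigma>"
    by (intro borel_measurable_times meas borel_measurable_integrable[OF f])
  have int: "integrable \<sigma> (\<lambda>\<xi>. ?i \<xi> * f \<xi>)"
    by (rule Bochner_Integration.integrable_bound[OF f meas_f]) (simp add: indicator_def)
  have T: "orthogonal_transformation (uminus :: real ^ 'n \<Rightarrow> _)"
    by (simp add: orthogonal_transformation_def linear_uminus)
  have refl_int: "integrable \<sigma> (\<lambda>\<xi>. ?i (- \<xi>) * f (- \<xi>))"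
    using integrable_distr[OF orthogonal_transformation_measurable[OF T], of "\<lambda>\<xi>. ?i \<xi> * f \<xi>"] int
    by (simp add: distr_orthogonal_transformation[OF T])
  have "(LINT \<xi>|\<sigma>. f \<xi>) = (LINT \<xi>|\<sigma>. ?i \<xi> * f \<xi> + ?i (- \<xi>) * f (- \<xi>))"
    using even zero by (intro Bochner_Integration.integral_cong) (auto simp: space_eq indicator_def)
  also have "\<dots> = (LINT \<xi>|\<sigma>. ?i \<xi> * f \<xi>) + (LINT \<xi>|\<sigma>. ?i (- \<xi>) * f (- \<xi>))"
    by (rule Bochner_Integration.integral_add[OF int refl_int])
  also have "(LINT \<xi>|\<sigma>. ?i (- \<xi>) * f (- \<xi>)) = (LINT \<xi>|\<sigma>. ?i \<xi> * f \<xi>)"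
    using integral_orthogonal_transformation[OF T meas_f] by simp
  finally show ?thesis
    by simp
qed

end

text \<open>Orthogonal maps are isometries and preserve the norm, so preimages of subsets of the
  sphere remain in the sphere and invariance passes to the restricted measure.\<close>

lemma invariant_sphere_measure_hausdorff:
  "invariant_sphere_measure (restrict_space (hausdorff_measure (CARD('n) - 1)) (sphere 0 1 :: (real ^ 'n::finite) set))"
proof (intro invariant_sphere_measure.intro finite_measureI invariant_sphere_measure_axioms.intro)
  let ?\<mu> = "hausdorff_measure (CARD('n) - 1) :: (real ^ 'n) measure"
  let ?S = "sphere 0 1 :: (real ^ 'n) set"
  have S: "?S \<inter> space ?\<mu> \<in> sets ?\<mu>"
    by simp
  show "emeasure (restrict_space ?\<mu> ?S) (space (restrict_space ?\<mu> ?S)) \<noteq> \<infinity>"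
    using emeasure_hausdorff_measure_sphere_finite[where 'a = "real ^ 'n"]
    unfolding space_restrict_space by (simp add: emeasure_restrict_space[OF S order_refl, simplified])
  show "sets (restrict_space ?\<mu> ?S) = sets (restrict_space borel ?S)"
    by (rule sets_restrict_space_cong) simp
  fix T :: "real ^ 'n \<Rightarrow> real ^ 'n" and A
  assume T: "orthogonal_transformation T" and A: "A \<in> sets (restrict_space ?\<mu> ?S)"
  have A': "A \<in> sets borel" "A \<subseteq> ?S"
    using A S by (auto simp: sets_restrict_space_iff)
  have sub: "T -` A \<subseteq> ?S"
    using A'(2) orthogonal_transformation_norm[OF T] by auto
  have "dist (T v) (T w) = dist v w" for v w
    using T by (simp add: orthogonal_transformation_isometry)
  then have "emeasure ?\<mu> (T -` A) = emeasure ?\<mu> A"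
    by (rule emeasure_hausdorff_measure_isometry[OF _ orthogonal_transformation_bij[OF T] A'(1)])
  then show "emeasure (restrict_space ?\<mu> ?S) (T -` A \<inter> ?S) = emeasure (restrict_space ?\<mu> ?S) A"
    by (simp only: emeasure_restrict_space[OF S sub] emeasure_restrict_space[OF S A'(2)] Int_absorb2[OF sub])
qed

theorem theorem1p3:
  fixes m n :: nat
    and L :: "(real ^ 'n::finite \<Rightarrow> real) \<Rightarrow> real ^ 'n \<Rightarrow> real"
    and Q :: "real ^ 'n \<Rightarrow> real"
    and x y \<eta> :: "real ^ 'n"
  assumes "m \<ge> 1"
    and "n = 2 * m + 2"
    and "CARD('n) = n"
    and "has_symbol m L Q"
    and "uniformly_elliptic m Q"
    and "x \<noteq> y"
    and "\<eta> = (x - y) /\<^sub>R norm (x - y)"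
  shows "john_fundamental_solution m Q x y =
    1 / (2 ^ (2 * m + 1) * pi ^ (2 * m + 2) * (norm (x - y))\<^sup>2) *
    ((real n - 2) / 2 * (LINT \<xi>:sphere 0 1|hausdorff_measure (n - 1). 1 / Q \<xi>) +
     (LINT \<xi>:{\<xi>. norm \<xi> = 1 \<and> (x - y) \<bullet> \<xi> > 0}|hausdorff_measure (n - 1).
        ln (\<xi> \<bullet> \<eta>) *
        ((4 * real m + 4 - real n) * (\<xi> \<bullet> \<eta>) * grad_form (\<lambda>z. 1 / Q z) \<xi> \<eta>
         + 2 * real m * (1 / Q \<xi>)
         + hess_form (\<lambda>z. 1 / Q z) \<xi> \<eta>
         + (\<xi> \<bullet> \<eta>)\<^sup>2 * laplacian (\<lambda>z. 1 / Q z) \<xi>)))"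
proof -
  define \<mu> where "\<mu> = (hausdorff_measure (n - 1) :: (real ^ 'n) measure)"
  define \<sigma> where "\<sigma> = restrict_space \<mu> (sphere 0 1 :: (real ^ 'n) set)"
  interpret invariant_sphere_measure \<sigma>
    using invariant_sphere_measure_hausdorff[where 'n = 'n] by (simp add: \<sigma>_def \<mu>_def assms(3))
  have LINT_\<sigma>: "(LINT \<xi>|\<sigma>. f \<xi>) = (LINT \<xi>:sphere 0 1|\<mu>. f \<xi>)" for f :: "real ^ 'n \<Rightarrow> real"
    unfolding \<sigma>_def set_lebesgue_integral_def by (subst integral_restrict_space) (simp_all add: \<mu>_def)
  obtain A where Q: "Q = symbol_poly m A"
    using assms(4) by (auto simp: has_symbol_def)
  obtain c where c: "c > 0" "\<And>\<xi>. Q \<xi> \<ge> c * norm \<xi> ^ (2 * m)"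
    using assms(5) by (auto simp: uniformly_elliptic_def)
  have Q_pos: "Q \<xi> > 0" if "\<xi> \<noteq> 0" for \<xi>
  proof -
    have "c * norm \<xi> ^ (2 * m) > 0"
      using c(1) that by simp
    then show ?thesis
      using c(2)[of \<xi>] by linarith
  qed
  have poly: "real_polynomial_function Q"
    unfolding Q by (rule real_polynomial_function_symbol_poly)
  have nz: "Q \<xi> \<noteq> 0" if "\<xi> \<noteq> 0" for \<xi>
    using Q_pos[OF that] by simp
  define g where "g = (\<lambda>z. 1 / Q z)"
  obtain G H where dg: "\<And>\<xi>. \<xi> \<noteq> 0 \<Longrightarrow> (g has_derivative (\<lambda>v. G \<xi> \<bullet> v)) (at \<xi>)"
    and dG: "\<And>\<xi>. \<xi> \<noteq> 0 \<Longrightarrow> (G has_derivative H \<xi>) (at \<xi>)"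
    and cont_H: "\<And>v. continuous_on (- {0}) (\<lambda>\<xi>. H \<xi> v)"
  proof (rule one_over_polynomial_derivatives[OF poly nz, folded g_def])
    fix G H
    assume "\<And>\<xi>. \<xi> \<noteq> 0 \<Longrightarrow> (g has_derivative (\<lambda>v. G \<xi> \<bullet> v)) (at \<xi>)"
      and "\<And>\<xi>. \<xi> \<noteq> 0 \<Longrightarrow> (G has_derivative H \<xi>) (at \<xi>)"
      and "\<And>v. continuous_on (- {0}) (\<lambda>\<xi>. H \<xi> v)"
    then show thesis
      by (rule that)
  qed
  have hom_g: "g (s *\<^sub>R \<xi>) = inverse (s ^ (2 * m)) *\<^sub>R g \<xi>" if "s \<noteq> 0" "\<xi> \<noteq> 0" for s \<xi>
    by (simp add: g_def Q symbol_poly_scaleR divide_inverse)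
  have hom_G: "G (s *\<^sub>R \<xi>) = inverse (s ^ Suc (2 * m)) *\<^sub>R G \<xi>" if "s \<noteq> 0" "\<xi> \<noteq> 0" for s \<xi>
  proof (rule vector_eq_ldot[THEN iffD1, rule_format])
    fix v
    show "v \<bullet> G (s *\<^sub>R \<xi>) = v \<bullet> (inverse (s ^ Suc (2 * m)) *\<^sub>R G \<xi>)"
      using has_derivative_homogeneous(2)[OF hom_g dg that(2,1), of v] by (simp add: inner_commute)
  qed
  have euler_g: "G \<xi> \<bullet> \<xi> = - (2 * real m) * g \<xi>" if "\<xi> \<noteq> 0" for \<xi>
    using has_derivative_homogeneous(1)[OF hom_g dg that] by simp
  have euler_G: "H \<xi> \<xi> = - real (Suc (2 * m)) *\<^sub>R G \<xi>" if "\<xi> \<noteq> 0" for \<xi>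
    by (rule has_derivative_homogeneous(1)[OF hom_G dG that])
  \<comment> \<open>Obtained by differentiating
    \<open>G \<xi> \<bullet> \<xi> = - 2 m g \<xi>\<close> in direction \<open>v\<close>, which
    gives the transposed radial term without appeal to symmetry of the Hessian.\<close>
  have euler_H: "H \<xi> v \<bullet> \<xi> = - (2 * real m + 1) * (G \<xi> \<bullet> v)" if "\<xi> \<noteq> 0" for \<xi> v
  proof -
    have 1: "((\<lambda>\<xi>. G \<xi> \<bullet> \<xi>) has_derivative (\<lambda>v. G \<xi> \<bullet> v + H \<xi> v \<bullet> \<xi>)) (at \<xi>)"
      by (rule has_derivative_inner[OF dG[OF that] has_derivative_ident])
    have "((\<lambda>\<xi>. - (2 * real m) * g \<xi>) has_derivative (\<lambda>v. - (2 * real m) * (G \<xi> \<bullet> v))) (at \<xi>)"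
      by (rule has_derivative_mult_right[OF dg[OF that]])
    then have 2: "((\<lambda>\<xi>. G \<xi> \<bullet> \<xi>) has_derivative (\<lambda>v. - (2 * real m) * (G \<xi> \<bullet> v))) (at \<xi>)"
      by (rule has_derivative_transform_within_open[of _ _ _ _ "- {0}"]) (auto simp: euler_g that)
    from fun_cong[OF has_derivative_unique[OF 1 2], of v] show ?thesis
      by (simp add: algebra_simps)
  qed
  have forms: "grad_form g \<xi> v = G \<xi> \<bullet> v" "hess_form g \<xi> v = H \<xi> v \<bullet> v"
    "laplacian g \<xi> = (\<Sum>i\<in>UNIV. H \<xi> (axis i 1) \<bullet> axis i 1)" if "\<xi> \<noteq> 0" for \<xi> v
    by (rule partial_forms_of_has_derivative[OF dg dG that]; assumption)+
  define bracket where "bracket \<xi> = (4 * real m + 4 - real n) * (\<xi> \<bullet> \<eta>) * grad_form g \<xi> \<eta>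
         + 2 * real m * g \<xi> + hess_form g \<xi> \<eta> + (\<xi> \<bullet> \<eta>)\<^sup>2 * laplacian g \<xi>" for \<xi>
  define S where "S \<xi> = (\<xi> \<bullet> \<eta>)\<^sup>2 * (\<Sum>i\<in>UNIV. H \<xi> (axis i 1) \<bullet> axis i 1) + H \<xi> \<eta> \<bullet> \<eta>
      - (\<xi> \<bullet> \<eta>) * (H \<xi> \<xi> \<bullet> \<eta> + H \<xi> \<eta> \<bullet> \<xi>)
      - G \<xi> \<bullet> (((real CARD('n) - 2) * (\<xi> \<bullet> \<eta>)) *\<^sub>R \<eta> + \<xi>)" for \<xi>
  have S: "S \<xi> = bracket \<xi>" if "\<xi> \<noteq> 0" for \<xi>
    using euler_g[OF that] unfolding S_def bracket_def forms[OF that] euler_G[OF that] euler_H[OF that]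
    by (simp add: inner_add_right assms(2,3) algebra_simps)
  \<comment> \<open>Homogeneity with \<open>s = -1\<close>: the degrees of \<open>g\<close> and
    \<open>H\<close> are even and that of \<open>G\<close> is odd, and the factor
    \<open>\<xi> \<bullet> \<eta>\<close> in front of the gradient term compensates.\<close>
  have even: "bracket (- \<xi>) = bracket \<xi>" if "\<xi> \<noteq> 0" for \<xi>
  proof -
    have "g (- \<xi>) = g \<xi>" "G (- \<xi>) = - G \<xi>" "H (- \<xi>) v = H \<xi> v" for v
      using hom_g[of "-1" \<xi>] hom_G[of "-1" \<xi>] has_derivative_homogeneous(2)[OF hom_G dG that, of "-1" v] that
      by simp_all
    then show ?thesis
      using that by (simp add: bracket_def forms)
  qed
  have n2: "2 \<le> CARD('n)"
    using assms(2,3) by simp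
  have cont_H': "continuous_on (sphere 0 1) (\<lambda>\<xi>. H \<xi> v)" for v
    by (rule continuous_on_subset[OF cont_H]) auto
  have sphere_nz: "\<xi> \<noteq> 0" if "\<xi> \<in> space \<sigma>" for \<xi>
    using that by (auto simp: space_eq)
  have lap: "integrable \<sigma> (\<lambda>\<xi>. ln \<bar>\<xi> \<bullet> \<eta>\<bar> * S \<xi>)"
    "laplacian (\<lambda>y. log_potential g (x - y)) y =
      ((real CARD('n) - 2) * (LINT \<xi>|\<sigma>. g \<xi>) + (LINT \<xi>|\<sigma>. ln \<bar>\<xi> \<bullet> \<eta>\<bar> * S \<xi>)) / (norm (x - y))\<^sup>2"
    unfolding S_def by (rule laplacian_log_potential[OF n2 assms(6,7) dg dG cont_H']; assumption)+
  have int: "integrable \<sigma> (\<lambda>\<xi>. ln \<bar>\<xi> \<bullet> \<eta>\<bar> * bracket \<xi>)"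
    using lap(1) by (simp add: S sphere_nz cong: Bochner_Integration.integrable_cong)
  have lap_eq: "laplacian (\<lambda>y. log_potential g (x - y)) y =
      ((real n - 2) * (LINT \<xi>|\<sigma>. g \<xi>) + (LINT \<xi>|\<sigma>. ln \<bar>\<xi> \<bullet> \<eta>\<bar> * bracket \<xi>)) / (norm (x - y))\<^sup>2"
    using lap(2) by (simp add: S sphere_nz assms(3) cong: Bochner_Integration.integral_cong)
  have pos_iff: "(x - y) \<bullet> \<xi> = norm (x - y) * (\<xi> \<bullet> \<eta>)" for \<xi>
    using assms(6) by (simp add: assms(7) inner_commute)
  have half: "(LINT \<xi>|\<sigma>. ln \<bar>\<xi> \<bullet> \<eta>\<bar> * bracket \<xi>) =
      2 * (LINT \<xi>:{\<xi>. norm \<xi> = 1 \<and> (x - y) \<bullet> \<xi> > 0}|\<mu>. ln (\<xi> \<bullet> \<eta>) * bracket \<xi>)"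
  proof -
    have "(LINT \<xi>|\<sigma>. ln \<bar>\<xi> \<bullet> \<eta>\<bar> * bracket \<xi>) =
        2 * (LINT \<xi>|\<sigma>. indicator {\<xi>. (x - y) \<bullet> \<xi> > 0} \<xi> * (ln \<bar>\<xi> \<bullet> \<eta>\<bar> * bracket \<xi>))"
    proof (rule integral_even_eq_half[OF int])
      show "ln \<bar>- \<xi> \<bullet> \<eta>\<bar> * bracket (- \<xi>) = ln \<bar>\<xi> \<bullet> \<eta>\<bar> * bracket \<xi>" if "norm \<xi> = 1" for \<xi>
      proof -
        have "\<xi> \<noteq> 0"
          using that by auto
        then show ?thesis
          by (simp add: even)
      qed
      \<comment> \<open>Here the default value \<open>ln 0 = 0\<close> makes the integrand vanish on
        the great sphere.\<close>
      show "ln \<bar>\<xi> \<bullet> \<eta>\<bar> * bracket \<xi> = 0" if "(x - y) \<bullet> \<xi> = 0" for \<xi>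
        using that assms(6) by (simp add: pos_iff)
    qed
    also have "(LINT \<xi>|\<sigma>. indicator {\<xi>. (x - y) \<bullet> \<xi> > 0} \<xi> * (ln \<bar>\<xi> \<bullet> \<eta>\<bar> * bracket \<xi>)) =
        (LINT \<xi>:{\<xi>. norm \<xi> = 1 \<and> (x - y) \<bullet> \<xi> > 0}|\<mu>. ln (\<xi> \<bullet> \<eta>) * bracket \<xi>)"
      unfolding LINT_\<sigma> set_lebesgue_integral_def using assms(6)
      by (intro Bochner_Integration.integral_cong) (auto simp: indicator_def pos_iff zero_less_mult_iff)
    finally show ?thesis .
  qed
  have "john_fundamental_solution m Q x y =
      1 / (2 * pi) ^ n * laplacian (\<lambda>y. log_potential g (x - y)) y"
  proof -
    \<comment> \<open>Exactly one negated Laplacian is applied, and its sign cancels the leading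
      minus of the definition.\<close>
    have "(CARD('n) - 2 * m) div 2 = 1"
      using assms(2,3) by simp
    then show ?thesis
      unfolding john_fundamental_solution_def log_potential_def LINT_\<sigma>
      by (simp add: g_def \<mu>_def assms(3))
  qed
  also have "\<dots> = 1 / (2 ^ (2 * m + 1) * pi ^ (2 * m + 2) * (norm (x - y))\<^sup>2) *
    ((real n - 2) / 2 * (LINT \<xi>|\<sigma>. g \<xi>) +
     (LINT \<xi>:{\<xi>. norm \<xi> = 1 \<and> (x - y) \<bullet> \<xi> > 0}|\<mu>. ln (\<xi> \<bullet> \<eta>) * bracket \<xi>))"
    unfolding lap_eq half using assms(2,6) by (simp add: power_mult_distrib field_simps)
  finally show ?thesis
    unfolding LINT_\<sigma> bracket_def by (simp add: g_def \<mu>_def)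
qed

end
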